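(* Let $\mathbb{O}$ be an octonion algebra over a field $F$, and let $A$ be a subalgebra. If $\mathbb{O}$ is split, write $\mathbb{O}=\mathbb{H}+\mathbb{H}w$ with $\mathbb{H}=F^{2\times2}$ and $w^2=1$, and put $p_0=\begin{pmatrix}1&0\\0&0\end{pmatrix}$, $n_0=\begin{pmatrix}0&1\\0&0\end{pmatrix}\in\mathbb{H}$ (cases below that mention $p_0,n_0,w$ refer to split $\mathbb{O}$). The subalgebra $A$ is commutative in the following cases: (a) $\dim A=1$. (b) $\dim A=2$, and $A=F+Fa\cong F[X]/(X^2-\mathrm{T}(a)X+N(a))$. (c) $\dim A=2$, and $A$ is in the $\mathrm{Aut}_F(\mathbb{O})$-orbit of $(Fp_0+Fn_0)w$. (d) $\dim A=3$, and $A$ is in the $\mathrm{Aut}_F(\mathbb{O})$-orbit of $F+(Fp_0+Fn_0)w$. If $\mathrm{char}\,F\ne2$ then these are the only commutative subalgebras. If $\mathrm{char}\,F=2$ there are the following additional cases (and no others): (e) $\dim A=3$, and $A$ is in the $\mathrm{Aut}_F(\mathbb{O})$-orbit of the Heisenberg algebra $Fn_0+(Fp_0+Fn_0)w$. (f) $\dim A=4$, and $A$ is in the $\mathrm{Aut}_F(\mathbb{O})$-orbit of $B+(Fp_0+Fn_0)w$, where $B=F+Fb$ with $b\in(1^\perp\cap\mathbb{H})\setminus F$. (g) $\dim A=4$, and $A$ is a totally inseparable field extension of $F$ of exponent $1$. In any case, every commutative subalgebra of $\mathbb{O}$ is associative, as well.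
   Context: $F$ is an arbitrary field. A composition algebra over $F$ is a (not necessarily associative) $F$-algebra $C$ with neutral element $1$ and a quadratic form $N\colon C\to F$ (norm) with $N(xy)=N(x)N(y)$ whose polar form $(x|y)=N(x+y)-N(x)-N(y)$ is non-degenerate. $F$ is identified with $F1$. An octonion algebra is a composition algebra of dimension $8$; it is split if some non-zero element has norm $0$. The standard involution is $x\mapsto\bar x=(x|1)1-x$, and the trace is $\mathrm{T}(x)=x+\bar x=(x|1)$. Orthogonality $\perp$ refers to the polar form. A subalgebra is an $F$-linear subspace closed under multiplication (it need not contain $1$). $\mathrm{Aut}_F(\mathbb{O})$ is the group of $F$-linear algebra automorphisms. The split octonion algebra is $\mathbb{O}=\mathbb{H}\oplus\mathbb{H}w$ with $\mathbb{H}=F^{2\times2}$, $\bar a$ the adjugate of $a\in\mathbb{H}$, multiplication $(a+xw)(b+yw)=(ab+\bar yx)+(ya+x\bar b)w$ and norm $N(a+xw)=\det a-\det x$. Exponent $1$ for a totally inseparable extension $K/F$ in characteristic $2$ means $x^2\in F$ for all $x\in K$. *)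

theory Defs
  imports "HOL-Analysis.Analysis" "HOL-Computational_Algebra.Polynomial"
begin

definition polar :: "('a::ab_group_add \<Rightarrow> 'f::field) \<Rightarrow> 'a \<Rightarrow> 'a \<Rightarrow> 'f" where
  "polar N x y = N (x + y) - N x - N y"

text \<open>
  The algebra is the whole type \<^typ>\<open>'a\<close>, with scalar multiplication \<open>smul\<close>,
  product \<open>mul\<close>, neutral element \<open>e\<close> and norm \<open>N\<close>.
\<close>

locale composition_algebra = vector_space smul
  for smul :: "'f::field \<Rightarrow> 'a::ab_group_add \<Rightarrow> 'a" +
  fixes mul :: "'a \<Rightarrow> 'a \<Rightarrow> 'a" and e :: 'a and N :: "'a \<Rightarrow> 'f"
  assumes linear_mult_left: "Vector_Spaces.linear smul smul (\<lambda>x. mul x y)"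
    and linear_mult_right: "Vector_Spaces.linear smul smul (\<lambda>y. mul x y)"
    and mult_e_left: "mul e x = x"
    and mult_e_right: "mul x e = x"
    and norm_scale: "N (smul c x) = c\<^sup>2 * N x"
    and linear_polar_left: "Vector_Spaces.linear smul (*) (\<lambda>x. polar N x y)"
    and linear_polar_right: "Vector_Spaces.linear smul (*) (\<lambda>y. polar N x y)"
    and norm_mult: "N (mul x y) = N x * N y"
    and nondegenerate: "(\<And>y. polar N x y = 0) \<Longrightarrow> x = 0"

text \<open>\<^const>\<open>vector_space.dim\<close> is \<open>0\<close> for infinite-dimensional spaces, so the
  assumption below includes finite dimensionality.\<close>

locale octonion_algebra = composition_algebra smul mul e N
  for smul :: "'f::field \<Rightarrow> 'a::ab_group_add \<Rightarrow> 'a" and mul e N +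
  assumes dim_8: "dim UNIV = 8"

definition is_split :: "('a::ab_group_add \<Rightarrow> 'f::field) \<Rightarrow> bool" where
  "is_split N \<longleftrightarrow> (\<exists>x. x \<noteq> 0 \<and> N x = 0)"

text \<open>The trace, with values in the field instead of its copy \<open>F1\<close> in the algebra.\<close>

definition trace_form :: "'a::ab_group_add \<Rightarrow> ('a \<Rightarrow> 'f::field) \<Rightarrow> 'a \<Rightarrow> 'f" where
  "trace_form e N x = polar N x e"

definition is_subalgebra ::
    "('f::field \<Rightarrow> 'a::ab_group_add \<Rightarrow> 'a) \<Rightarrow> ('a \<Rightarrow> 'a \<Rightarrow> 'a) \<Rightarrow> 'a set \<Rightarrow> bool" where
  "is_subalgebra smul mul A \<longleftrightarrow>
     module.subspace smul A \<and> (\<forall>x\<in>A. \<forall>y\<in>A. mul x y \<in> A)"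

definition commutative_on :: "('a \<Rightarrow> 'a \<Rightarrow> 'a) \<Rightarrow> 'a set \<Rightarrow> bool" where
  "commutative_on mul A \<longleftrightarrow> (\<forall>x\<in>A. \<forall>y\<in>A. mul x y = mul y x)"

definition associative_on :: "('a \<Rightarrow> 'a \<Rightarrow> 'a) \<Rightarrow> 'a set \<Rightarrow> bool" where
  "associative_on mul A \<longleftrightarrow>
     (\<forall>x\<in>A. \<forall>y\<in>A. \<forall>z\<in>A. mul (mul x y) z = mul x (mul y z))"

definition algebra_aut ::
    "('f::field \<Rightarrow> 'a::ab_group_add \<Rightarrow> 'a) \<Rightarrow> ('a \<Rightarrow> 'a \<Rightarrow> 'a) \<Rightarrow> ('a \<Rightarrow> 'a) set" where
  "algebra_aut smul mul =
     {f. Vector_Spaces.linear smul smul f \<and> bij f \<and>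
         (\<forall>x y. f (mul x y) = mul (f x) (f y))}"

definition aut_orbit ::
    "('f::field \<Rightarrow> 'a::ab_group_add \<Rightarrow> 'a) \<Rightarrow> ('a \<Rightarrow> 'a \<Rightarrow> 'a) \<Rightarrow> 'a set \<Rightarrow> 'a set set" where
  "aut_orbit smul mul X = {f ` X | f. f \<in> algebra_aut smul mul}"


section \<open>The split octonion algebra\<close>

text \<open>The pair \<open>(a, x)\<close> of matrices stands for \<open>a + xw\<close>.\<close>

type_synonym 'f mat2 = "'f^2^2"

definition mat_scale :: "'f::field \<Rightarrow> 'f mat2 \<Rightarrow> 'f mat2" where
  "mat_scale c a = (\<chi> i j. c * a $ i $ j)"

definition adjugate2 :: "'f::field mat2 \<Rightarrow> 'f mat2" where
  "adjugate2 a = vector [vector [a $ 2 $ 2, - a $ 1 $ 2], vector [- a $ 2 $ 1, a $ 1 $ 1]]"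

definition std_scale :: "'f::field \<Rightarrow> 'f mat2 \<times> 'f mat2 \<Rightarrow> 'f mat2 \<times> 'f mat2" where
  "std_scale c u = (mat_scale c (fst u), mat_scale c (snd u))"

fun std_mult ::
    "'f::field mat2 \<times> 'f mat2 \<Rightarrow> 'f mat2 \<times> 'f mat2 \<Rightarrow> 'f mat2 \<times> 'f mat2" where
  "std_mult (a, x) (b, y) = (a ** b + adjugate2 y ** x, y ** a + x ** adjugate2 b)"

definition std_norm :: "'f::field mat2 \<times> 'f mat2 \<Rightarrow> 'f" where
  "std_norm u = det (fst u) - det (snd u)"

text \<open>An identification of an octonion algebra with \<open>\<H> + \<H>w\<close>.\<close>

definition split_coordinates ::
    "('f::field \<Rightarrow> 'a::ab_group_add \<Rightarrow> 'a) \<Rightarrow> ('a \<Rightarrow> 'a \<Rightarrow> 'a) \<Rightarrow> ('a \<Rightarrow> 'f) \<Rightarrow>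
     ('f mat2 \<times> 'f mat2 \<Rightarrow> 'a) \<Rightarrow> bool" where
  "split_coordinates smul mul N \<phi> \<longleftrightarrow>
     Vector_Spaces.linear std_scale smul \<phi> \<and> bij \<phi> \<and>
     (\<forall>u v. \<phi> (std_mult u v) = mul (\<phi> u) (\<phi> v)) \<and>
     (\<forall>u. N (\<phi> u) = std_norm u)"

definition p0 :: "'f::field mat2" where
  "p0 = vector [vector [1, 0], vector [0, 0]]"

definition n0 :: "'f::field mat2" where
  "n0 = vector [vector [0, 1], vector [0, 0]]"

text \<open>The model algebras \<open>(Fp\<^sub>0 + Fn\<^sub>0)w\<close>, \<open>F + (Fp\<^sub>0 + Fn\<^sub>0)w\<close>, \<open>Fn\<^sub>0 + (Fp\<^sub>0 + Fn\<^sub>0)w\<close> and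
  \<open>F + Fb + (Fp\<^sub>0 + Fn\<^sub>0)w\<close>; here \<^term>\<open>mat r\<close> is the scalar matrix with entry \<open>r\<close>.\<close>

definition model_null :: "('f::field mat2 \<times> 'f mat2) set" where
  "model_null = {(0, mat_scale s p0 + mat_scale t n0) | s t. True}"

definition model_unital_null :: "('f::field mat2 \<times> 'f mat2) set" where
  "model_unital_null = {(mat r, mat_scale s p0 + mat_scale t n0) | r s t. True}"

definition model_heisenberg :: "('f::field mat2 \<times> 'f mat2) set" where
  "model_heisenberg = {(mat_scale r n0, mat_scale s p0 + mat_scale t n0) | r s t. True}"

definition model_B :: "'f::field mat2 \<Rightarrow> ('f mat2 \<times> 'f mat2) set" where
  "model_B b =
     {(mat r + mat_scale q b, mat_scale s p0 + mat_scale t n0) | r q s t. True}"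


section \<open>The cases\<close>

definition one_gen :: "('f::field \<Rightarrow> 'a::ab_group_add \<Rightarrow> 'a) \<Rightarrow> 'a \<Rightarrow> 'a \<Rightarrow> 'a set" where
  "one_gen smul e a = {smul r e + smul s a | r s. True}"

definition poly_coset :: "'f::field poly \<Rightarrow> 'f poly \<Rightarrow> 'f poly set" where
  "poly_coset q p = {r. q dvd (r - p)}"

text \<open>The subalgebra \<open>A\<close> is isomorphic, as an \<open>F\<close>-algebra with neutral element \<open>e\<close>, to
  \<open>F[X]/(q)\<close>.\<close>

definition iso_poly_quotient ::
    "('f::field \<Rightarrow> 'a::ab_group_add \<Rightarrow> 'a) \<Rightarrow> ('a \<Rightarrow> 'a \<Rightarrow> 'a) \<Rightarrow> 'a \<Rightarrow> 'a set \<Rightarrow> 'f poly \<Rightarrow> bool"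
  where
  "iso_poly_quotient smul mul e A q \<longleftrightarrow>
     (\<exists>\<psi>. bij_betw \<psi> (range (poly_coset q)) A \<and>
        \<psi> (poly_coset q 1) = e \<and>
        (\<forall>p r. \<psi> (poly_coset q (p + r)) = \<psi> (poly_coset q p) + \<psi> (poly_coset q r)) \<and>
        (\<forall>p r. \<psi> (poly_coset q (p * r)) = mul (\<psi> (poly_coset q p)) (\<psi> (poly_coset q r))) \<and>
        (\<forall>c p. \<psi> (poly_coset q (smult c p)) = smul c (\<psi> (poly_coset q p))))"

definition case_a where
  "case_a smul A \<longleftrightarrow> vector_space.dim smul A = 1"

text \<open>The isomorphism with the polynomial quotient is a consequence, not a part of this case.\<close>

definition case_b where
  "case_b smul e A \<longleftrightarrow> vector_space.dim smul A = 2 \<and> (\<exists>a. A = one_gen smul e a)"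

definition case_c where
  "case_c smul mul N \<phi> A \<longleftrightarrow> is_split N \<and> vector_space.dim smul A = 2 \<and>
     A \<in> aut_orbit smul mul (\<phi> ` model_null)"

definition case_d where
  "case_d smul mul N \<phi> A \<longleftrightarrow> is_split N \<and> vector_space.dim smul A = 3 \<and>
     A \<in> aut_orbit smul mul (\<phi> ` model_unital_null)"

definition case_e where
  "case_e smul mul N \<phi> A \<longleftrightarrow> is_split N \<and> vector_space.dim smul A = 3 \<and>
     A \<in> aut_orbit smul mul (\<phi> ` model_heisenberg)"

definition case_f where
  "case_f smul mul N \<phi> A \<longleftrightarrow> is_split N \<and> vector_space.dim smul A = 4 \<and>
     (\<exists>b. polar std_norm (b, 0) (mat 1, 0) = 0 \<and> b \<notin> range mat \<and>
        A \<in> aut_orbit smul mul (\<phi> ` model_B b))"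

definition field_extension_in where
  "field_extension_in smul mul e A \<longleftrightarrow>
     is_subalgebra smul mul A \<and> e \<in> A \<and> e \<noteq> 0 \<and>
     commutative_on mul A \<and> associative_on mul A \<and>
     (\<forall>x\<in>A. x \<noteq> 0 \<longrightarrow> (\<exists>y\<in>A. mul x y = e))"

text \<open>Total inseparability of exponent \<open>1\<close> in characteristic \<open>2\<close>.\<close>

definition case_g where
  "case_g smul mul e A \<longleftrightarrow> vector_space.dim smul A = 4 \<and>
     field_extension_in smul mul e A \<and> (\<forall>x\<in>A. mul x x \<in> range (\<lambda>c. smul c e))"

end

theory Submission
  imports Defs
begin

text \<open>
  If a commutative subalgebra \<open>A\<close> contains \<open>x\<close> with \<open>T(x)\<^sup>2 \<noteq> 4 N(x)\<close>, then \<open>x\<close> commutes only with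
  \<open>F + Fx\<close>, so \<open>A \<subseteq> F + Fx\<close>.  Otherwise the elements of \<open>A\<close> of norm and trace zero form a
  subspace on which the polar form vanishes.  If it has dimension at least two, it contains
  independent \<open>u\<close>, \<open>v\<close> with \<open>uv = 0\<close> (if some product \<open>xy\<close> in it is non-zero, take \<open>u = y\<close> and
  \<open>v = xy\<close>), and there are split coordinates with \<open>u = p\<^sub>0w\<close>, \<open>v = n\<^sub>0w\<close>.  Commuting with these two
  elements forces \<open>A = R + (Fp\<^sub>0 + Fn\<^sub>0)w\<close> with \<open>R\<close> consisting of matrices equal to their adjugate,
  and \<open>R\<close> is easily determined.  If it has dimension at most one, then \<open>A\<close> has dimension at
  most two, or the characteristic is two and \<open>A\<close> is an anisotropic field; that field is totally
  isotropic for the polar form, hence of dimension at most four.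

  Orbits under the automorphism group are handled by constructing coordinates adapted to \<open>A\<close>: any
  two systems of split coordinates differ by an automorphism.  Such coordinates arise from a
  hyperbolic pair of null elements of trace zero, which generates a copy of \<open>F\<^sup>2\<^sup>\<times>\<^sup>2\<close>, by
  Cayley--Dickson doubling.
\<close>

section \<open>Identities in composition algebras\<close>

context composition_algebra
begin

notation smul (infixr "\<cdot>" 75)
notation mul (infixl "\<odot>" 70)

abbreviation B :: "'a \<Rightarrow> 'a \<Rightarrow> 'f" where
  "B x y \<equiv> polar N x y"

abbreviation T :: "'a \<Rightarrow> 'f" where
  "T x \<equiv> polar N x e"

definition bar :: "'a \<Rightarrow> 'a" where
  "bar x = T x \<cdot> e - x"

lemma mul_add_left: "(x + y) \<odot> z = x \<odot> z + y \<odot> z"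
  and mul_scale_left: "(c \<cdot> x) \<odot> z = c \<cdot> (x \<odot> z)"
  and mul_diff_left: "(x - y) \<odot> z = x \<odot> z - y \<odot> z"
  and mul_minus_left: "(- x) \<odot> z = - (x \<odot> z)"
  and mul_zero_left: "0 \<odot> z = 0"
proof -
  interpret l: Vector_Spaces.linear smul smul "\<lambda>x. x \<odot> z"
    by (rule linear_mult_left)
  show "(x + y) \<odot> z = x \<odot> z + y \<odot> z" by (rule l.add)
  show "(c \<cdot> x) \<odot> z = c \<cdot> (x \<odot> z)" by (rule l.scale)
  show "(x - y) \<odot> z = x \<odot> z - y \<odot> z" by (rule l.diff)
  show "(- x) \<odot> z = - (x \<odot> z)" by (rule l.neg)
  show "0 \<odot> z = 0" by (rule l.zero)
qed

lemma mul_add_right: "z \<odot> (x + y) = z \<odot> x + z \<odot> y"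
  and mul_scale_right: "z \<odot> (c \<cdot> x) = c \<cdot> (z \<odot> x)"
  and mul_diff_right: "z \<odot> (x - y) = z \<odot> x - z \<odot> y"
  and mul_minus_right: "z \<odot> (- x) = - (z \<odot> x)"
  and mul_zero_right: "z \<odot> 0 = 0"
proof -
  interpret l: Vector_Spaces.linear smul smul "\<lambda>x. z \<odot> x"
    by (rule linear_mult_right)
  show "z \<odot> (x + y) = z \<odot> x + z \<odot> y" by (rule l.add)
  show "z \<odot> (c \<cdot> x) = c \<cdot> (z \<odot> x)" by (rule l.scale)
  show "z \<odot> (x - y) = z \<odot> x - z \<odot> y" by (rule l.diff)
  show "z \<odot> (- x) = - (z \<odot> x)" by (rule l.neg)
  show "z \<odot> 0 = 0" by (rule l.zero)
qed

lemma polar_add_left: "B (x + y) z = B x z + B y z"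
  and polar_scale_left: "B (c \<cdot> x) z = c * B x z"
  and polar_diff_left: "B (x - y) z = B x z - B y z"
  and polar_minus_left: "B (- x) z = - B x z"
  and polar_zero_left: "B 0 z = 0"
proof -
  interpret l: Vector_Spaces.linear smul "(*)" "\<lambda>x. B x z"
    by (rule linear_polar_left)
  show "B (x + y) z = B x z + B y z" by (rule l.add)
  show "B (c \<cdot> x) z = c * B x z" by (rule l.scale)
  show "B (x - y) z = B x z - B y z" by (rule l.diff)
  show "B (- x) z = - B x z" by (rule l.neg)
  show "B 0 z = 0" by (rule l.zero)
qed

lemma polar_sym: "B x y = B y x"
  by (simp add: polar_def add.commute)

lemma polar_add_right: "B z (x + y) = B z x + B z y"
  and polar_scale_right: "B z (c \<cdot> x) = c * B z x"
  and polar_diff_right: "B z (x - y) = B z x - B z y"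
  and polar_minus_right: "B z (- x) = - B z x"
  and polar_zero_right: "B z 0 = 0"
  by (simp_all add: polar_sym[of z] polar_add_left polar_scale_left polar_diff_left
      polar_minus_left polar_zero_left)

lemmas alg_simps = mul_add_left mul_scale_left mul_diff_left mul_minus_left mul_zero_left
  mul_add_right mul_scale_right mul_diff_right mul_minus_right mul_zero_right
  mult_e_left mult_e_right

lemmas polar_simps = polar_add_left polar_scale_left polar_diff_left polar_minus_left
  polar_zero_left polar_add_right polar_scale_right polar_diff_right polar_minus_right
  polar_zero_right

lemma norm_add: "N (x + y) = N x + N y + B x y"
  by (simp add: polar_def)

lemma norm_zero: "N 0 = 0"
  using norm_scale[of 0 0] by simp

lemma norm_minus: "N (- x) = N x"
  using norm_scale[of "-1" x] by simp

lemma polar_self: "B x x = 2 * N x"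
proof -
  have "x + x = 2 \<cdot> x"
    using scale_left_distrib[of 1 1 x] by simp
  then show ?thesis
    by (simp add: polar_def norm_scale)
qed

lemma polar_eqI:
  assumes "\<And>z. B x z = B y z"
  shows "x = y"
proof -
  have "x - y = 0"
    by (rule nondegenerate) (simp add: polar_simps assms)
  then show ?thesis by simp
qed

section \<open>Polarizing the norm, and the alternative laws\<close>

lemma polar_mul_mul_left: "B (x \<odot> y) (x \<odot> z) = N x * B y z"
  by (simp add: polar_def norm_mult right_diff_distrib flip: mul_add_right)

lemma polar_mul_mul_right: "B (y \<odot> x) (z \<odot> x) = B y z * N x"
  by (simp add: polar_def norm_mult left_diff_distrib flip: mul_add_left)

text \<open>Polarization of \<open>norm_mult\<close> in both factors. Setting one argument to
  \<open>e\<close> makes multiplication by \<open>x\<close> and by \<open>bar x\<close> adjoint to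
  each other, and the later identities rest on this.\<close>

lemma polar_exchange: "B (x \<odot> y) (z \<odot> w) + B (x \<odot> w) (z \<odot> y) = B x z * B y w"
proof -
  have "B ((x + z) \<odot> y) ((x + z) \<odot> w) = N (x + z) * B y w"
    by (rule polar_mul_mul_left)
  then show ?thesis
    by (simp add: alg_simps polar_simps norm_add polar_mul_mul_left algebra_simps
        polar_sym[of "x \<odot> w"])
qed

lemma polar_mul_left: "B (x \<odot> y) z = B y (bar x \<odot> z)"
  using polar_exchange[of x y e z]
  by (simp add: bar_def alg_simps polar_simps polar_sym algebra_simps)

lemma polar_mul_right: "B (x \<odot> y) z = B x (z \<odot> bar y)"
  using polar_exchange[of x y z e]
  by (simp add: bar_def alg_simps polar_simps polar_sym algebra_simps)

lemma bar_add: "bar (x + y) = bar x + bar y"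
  by (simp add: bar_def polar_simps algebra_simps)

text \<open>Paired with any \<open>z\<close>, the left side becomes
  \<open>B (x \<odot> y) (x \<odot> z)\<close> by adjointness, that is \<open>N x * B y z\<close>;
  nondegeneracy then removes \<open>z\<close>.\<close>

lemma bar_mul_cancel: "bar x \<odot> (x \<odot> y) = N x \<cdot> y"
  by (rule polar_eqI)
    (metis polar_mul_left polar_mul_mul_left polar_scale_left polar_sym)

lemma mul_bar_cancel: "(y \<odot> x) \<odot> bar x = N x \<cdot> y"
  by (rule polar_eqI)
    (metis mult.commute polar_mul_right polar_mul_mul_right polar_scale_left polar_sym)

text \<open>The quadratic equation of \<open>x\<close>, which is \<open>bar_mul_cancel\<close>
  applied to \<open>e\<close>.\<close>

lemma square: "x \<odot> x = T x \<cdot> x - N x \<cdot> e"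
  using bar_mul_cancel[of x e] by (simp add: bar_def alg_simps algebra_simps)

lemma bar_mul: "bar x \<odot> x = N x \<cdot> e"
  using bar_mul_cancel[of x e] by (simp add: alg_simps)

lemma mul_bar: "x \<odot> bar x = N x \<cdot> e"
  using mul_bar_cancel[of e x] by (simp add: alg_simps)

lemma left_alternative: "x \<odot> (x \<odot> y) = (x \<odot> x) \<odot> y"
  using bar_mul_cancel[of x y] by (simp add: bar_def square alg_simps algebra_simps)

lemma right_alternative: "(y \<odot> x) \<odot> x = y \<odot> (x \<odot> x)"
  using mul_bar_cancel[of y x] by (simp add: bar_def square alg_simps algebra_simps)

text \<open>Expanding the right alternative law with repeated factor \<open>x + y\<close> leaves
  flexibility once the two alternative laws cancel the other mixed terms.\<close>

lemma flexible: "(x \<odot> y) \<odot> x = x \<odot> (y \<odot> x)"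
  using right_alternative[of x "x + y"] right_alternative[of x y] left_alternative[of x y]
    right_alternative[of x x]
  by (simp add: alg_simps algebra_simps)

text \<open>The polarized quadratic equation. For commuting elements it becomes a formula for
  \<open>2 \<cdot> (x \<odot> y)\<close>.\<close>

lemma mul_swap: "x \<odot> y + y \<odot> x = T x \<cdot> y + T y \<cdot> x - B x y \<cdot> e"
  using square[of "x + y"] square[of x] square[of y]
  by (simp add: alg_simps polar_simps norm_add algebra_simps)

lemma bar_mul_exchange: "x \<odot> (bar y \<odot> z) + y \<odot> (bar x \<odot> z) = B x y \<cdot> z"
proof -
  have *: "x \<odot> (bar x \<odot> z) = N x \<cdot> z" for x
    using left_alternative[of x z] by (simp add: bar_def alg_simps square algebra_simps)
  show ?thesis
    using *[of "x + y"] *[of x] *[of y]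
    by (simp add: bar_add norm_add alg_simps algebra_simps)
qed

lemma mul_bar_exchange: "(z \<odot> bar x) \<odot> y + (z \<odot> bar y) \<odot> x = B x y \<cdot> z"
proof -
  have *: "(z \<odot> bar x) \<odot> x = N x \<cdot> z" for x
    using right_alternative[of z x] by (simp add: bar_def alg_simps square algebra_simps)
  show ?thesis
    using *[of "x + y"] *[of x] *[of y]
    by (simp add: bar_add norm_add alg_simps algebra_simps)
qed


section \<open>The norm of the identity, conjugation and doubling\<close>

lemma norm_e:
  assumes "e \<noteq> 0"
  shows "N e = 1"
proof -
  obtain y where y: "B e y \<noteq> 0"
    using nondegenerate assms by blast
  have "N e * N e = N e"
    using norm_mult[of e e] by (simp add: mult_e_left)
  \<comment> \<open>If \<open>N e\<close> were zero, \<open>B e y = N e * B e y\<close> would make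
    \<open>e\<close> orthogonal to everything.\<close>
  moreover have "N e \<noteq> 0"
    using y polar_mul_mul_left[of e e y] by (auto simp: mult_e_left)
  ultimately show ?thesis by simp
qed

lemma T_e: "e \<noteq> 0 \<Longrightarrow> T e = 2"
  by (simp add: polar_self norm_e)

lemma T_mul: "T (x \<odot> y) = B x (bar y)"
  by (simp add: polar_mul_right mult_e_left)

lemma bar_bar: "e \<noteq> 0 \<Longrightarrow> bar (bar x) = x"
  by (simp add: bar_def polar_simps T_e algebra_simps flip: scale_left_distrib)

lemma bar_mul_distrib:
  assumes "e \<noteq> 0"
  shows "bar (x \<odot> y) = bar y \<odot> bar x"
proof -
  have "T x * T y = T (x \<odot> y) + B x y"
    by (simp add: T_mul bar_def polar_simps)
  then show ?thesis
    using mul_swap[of x y]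
    by (simp add: bar_def alg_simps algebra_simps)
qed

text \<open>The multiplication rules of the doubling process, for a \<open>z\<close> orthogonal to
  all elements involved. With \<open>N z = - 1\<close> they are the rules that define
  \<open>std_mult\<close>.\<close>

lemma cayley_dickson_doubling:
  assumes "e \<noteq> 0"
    and "B z e = 0" and "B z x = 0" and "B z y = 0" and "B z (x \<odot> y) = 0" and "B z (y \<odot> x) = 0"
  shows "x \<odot> (y \<odot> z) = (y \<odot> x) \<odot> z"
    and "(x \<odot> z) \<odot> y = (x \<odot> bar y) \<odot> z"
    and "(x \<odot> z) \<odot> (y \<odot> z) = - N z \<cdot> (bar y \<odot> x)"
proof -
  have cz: "bar z = - z"
    using assms by (simp add: bar_def)
  \<comment> \<open>Moving \<open>z\<close> across an orthogonal \<open>u\<close> conjugates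
    \<open>u\<close>; \<open>l\<close> and \<open>r\<close> do the same inside a product of three
    factors.\<close>
  have swap: "u \<odot> z = z \<odot> bar u" if "B z u = 0" for u
    using mul_swap[of u z] that assms
    by (simp add: bar_def alg_simps algebra_simps polar_sym)
  have l: "u \<odot> (z \<odot> w) = z \<odot> (bar u \<odot> w)" if "B z u = 0" for u w
    using bar_mul_exchange[of u z w] that
    by (simp add: cz alg_simps algebra_simps polar_sym)
  have r: "(w \<odot> z) \<odot> u = (w \<odot> bar u) \<odot> z" if "B z u = 0" for u w
    using mul_bar_exchange[of w z u] that
    by (simp add: cz alg_simps algebra_simps polar_sym)
  show "x \<odot> (y \<odot> z) = (y \<odot> x) \<odot> z"
    using assms by (simp add: swap l bar_mul_distrib)
  show "(x \<odot> z) \<odot> y = (x \<odot> bar y) \<odot> z"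
    using assms by (simp add: r)
  have zz: "z \<odot> (z \<odot> w) = - N z \<cdot> w" for w
    using left_alternative[of z w] assms by (simp add: square alg_simps)
  have Bxz: "B z (x \<odot> z) = T x * N z"
    using polar_mul_mul_right[of e z x] by (simp add: mult_e_left polar_sym)
  have Txz: "bar (x \<odot> z) = - (x \<odot> z)"
    using assms T_mul[of x z] by (simp add: bar_def[of "x \<odot> z"] cz polar_simps polar_sym[of x z])
  have "(x \<odot> z) \<odot> (y \<odot> z) = (x \<odot> z) \<odot> (z \<odot> bar y)"
    using assms by (simp add: swap)
  \<comment> \<open>Since \<open>x \<odot> z\<close> and \<open>z\<close> need not be orthogonal, a
    term with \<open>T x * N z\<close> appears. In the last line it turns \<open>bar x\<close> back
    into \<open>x\<close>.\<close>
  also have "\<dots> = - (z \<odot> ((x \<odot> z) \<odot> bar y)) - (T x * N z) \<cdot> bar y"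
    using bar_mul_exchange[of "x \<odot> z" z "bar y"] Bxz Txz
    by (simp add: cz alg_simps algebra_simps polar_sym)
  also have "(x \<odot> z) \<odot> bar y = (x \<odot> y) \<odot> z"
    using r[of "bar y" x] assms by (simp add: bar_bar) (simp add: bar_def polar_simps)
  also have "\<dots> = z \<odot> (bar y \<odot> bar x)"
    using assms by (simp add: swap bar_mul_distrib)
  finally show "(x \<odot> z) \<odot> (y \<odot> z) = - N z \<cdot> (bar y \<odot> x)"
    by (simp add: zz bar_def[of x] alg_simps algebra_simps)
qed

section \<open>Duality and dimension\<close>

text \<open>Induction on \<open>S\<close>: nondegeneracy settles the empty set, and a new vector
  outside the span is handled by means of a vector dual to it.\<close>

lemma polar_separates:
  assumes "finite S" and "v \<notin> span S"
  shows "\<exists>y. (\<forall>s\<in>S. B s y = 0) \<and> B v y = 1"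
  using assms
proof (induction S arbitrary: v rule: finite_induct)
  case empty
  then have "v \<noteq> 0" by (simp add: span_empty)
  then obtain y where "B v y \<noteq> 0"
    using nondegenerate by blast
  then have "B v (inverse (B v y) \<cdot> y) = 1"
    by (simp add: polar_simps)
  then show ?case by blast
next
  case (insert s S)
  show ?case
  proof (cases "s \<in> span S")
    case True
    then have "v \<notin> span S"
      using insert.prems span_redundant by auto
    then obtain y where y: "\<forall>s\<in>S. B s y = 0" "B v y = 1"
      using insert.IH by blast
    have "B x y = 0" if "x \<in> span S" for x
      using that
      by (induction rule: span_induct_alt) (auto simp: polar_simps y)
    then show ?thesis using y True by blast
  next
    case False
    then obtain y1 where y1: "\<forall>s\<in>S. B s y1 = 0" "B s y1 = 1"
      using insert.IH by blast
    \<comment> \<open>Chosen so that \<open>B v' y1 = 0\<close>. Correcting \<open>y2\<close> by a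
      multiple of \<open>y1\<close> then kills the pairing with \<open>s\<close>, and the pairing
      with \<open>v\<close> becomes \<open>B v' y2\<close>.\<close>
    define v' where "v' = v - B v y1 \<cdot> s"
    have "v' \<notin> span S"
    proof
      assume "v' \<in> span S"
      then have "v' + B v y1 \<cdot> s \<in> span (insert s S)"
        by (meson insertI1 span_add span_base span_mono span_scale subset_insertI subsetD)
      then show False
        using insert.prems by (simp add: v'_def)
    qed
    then obtain y2 where y2: "\<forall>s\<in>S. B s y2 = 0" "B v' y2 = 1"
      using insert.IH by blast
    have "B s (y2 - B s y2 \<cdot> y1) = 0" "B v (y2 - B s y2 \<cdot> y1) = 1"
      "\<forall>t\<in>S. B t (y2 - B s y2 \<cdot> y1) = 0"
      using y1 y2 by (auto simp: v'_def polar_simps algebra_simps)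
    then show ?thesis by blast
  qed
qed

lemma dual_family_independent:
  assumes I: "finite I"
    and dual: "\<And>i j. i \<in> I \<Longrightarrow> j \<in> I \<Longrightarrow> B (b i) (d j) = (if i = j then 1 else 0)"
  shows "inj_on b I" and "independent (b ` I)"
proof -
  show inj: "inj_on b I"
    by (rule inj_onI) (metis dual zero_neq_one)
  show "independent (b ` I)"
  proof (rule independent_if_scalars_zero)
    fix f x
    assume 0: "(\<Sum>x\<in>b ` I. f x \<cdot> x) = 0" and "x \<in> b ` I"
    then obtain j where j: "j \<in> I" "x = b j" by blast
    have "0 = B (\<Sum>i\<in>I. f (b i) \<cdot> b i) (d j)"
      using 0 by (simp add: sum.reindex[OF inj] polar_zero_left)
    also have "\<dots> = (\<Sum>i\<in>I. B (f (b i) \<cdot> b i) (d j))"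
      by (rule additive.sum[OF additive.intro]) (simp add: polar_add_left)
    also have "\<dots> = (\<Sum>i\<in>I. if i = j then f (b i) else 0)"
      using j by (intro sum.cong) (auto simp: polar_simps dual)
    also have "\<dots> = f x"
      using j I by simp
    finally show "f x = 0" by simp
  qed (use I in simp)
qed

end

section \<open>Bases and dimension bounds in dimension eight\<close>

context octonion_algebra
begin

text \<open>The locale of finite-dimensional spaces has a basis as parameter; choosing one here
  allows that locale to be interpreted locally.\<close>

lemma finite_basis: "\<exists>S. finite_dimensional_vector_space smul S \<and> card S = 8"
proof -
  obtain S where "independent S" "UNIV \<subseteq> span S" "card S = 8"
    using basis_exists[of UNIV] dim_8 by metis
  moreover from \<open>card S = 8\<close> have "finite S"
    using card.infinite by fastforce
  ultimately show ?thesis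
    by (metis finite_dimensional_vector_space.intro finite_dimensional_vector_space_axioms.intro
        top.extremum_uniqueI vector_space_axioms)
qed

lemma independent_bound:
  assumes "independent S"
  shows "finite S" and "card S \<le> 8"
proof -
  obtain C where "finite_dimensional_vector_space smul C" and C: "card C = 8"
    using finite_basis by blast
  then interpret fd: finite_dimensional_vector_space smul C by simp
  show "finite S" "card S \<le> 8"
    using fd.independent_bound_general[OF assms] fd.dim_subset_UNIV[of S] C
    by (auto simp: fd.dimension_def)
qed

lemma span_independent_8:
  assumes "independent S" and "card S = 8"
  shows "span S = UNIV"
proof -
  have "v \<in> span S" for v
  proof (rule ccontr)
    assume v: "v \<notin> span S"
    then have "independent (insert v S)"
      using assms independent_insertI by blast
    moreover have "v \<notin> S" using v span_base by blast
    ultimately show False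
      using independent_bound[of "insert v S"] assms by simp
  qed
  then show ?thesis by blast
qed

lemma ex_notin_span:
  assumes "finite S" and "card S < 8"
  shows "\<exists>v. v \<notin> span S"
proof (rule ccontr)
  assume "\<nexists>v. v \<notin> span S"
  then have "UNIV \<subseteq> span S" by blast
  then show False
    using dim_le_card[of UNIV S] assms dim_8 by simp
qed

lemma e_nonzero: "e \<noteq> 0"
proof
  assume "e = 0"
  then have "x = 0" for x :: 'a
    using mult_e_left[of x] by (simp add: mul_zero_left)
  then show False
    using ex_notin_span[of "{}"] by auto
qed

lemma N_e: "N e = 1"
  by (rule norm_e) (rule e_nonzero)

lemma T_e_2: "T e = 2"
  by (rule T_e) (rule e_nonzero)

lemma exists_dim_basis:
  assumes "subspace A"
  obtains S where "finite S" "independent S" "span S = A" "card S = dim A"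
proof -
  obtain S where S: "S \<subseteq> A" "independent S" "A \<subseteq> span S" "card S = dim A"
    using basis_exists[of A] by metis
  then have "span S = A"
    using assms span_minimal by blast
  then show thesis using that S independent_bound by blast
qed

text \<open>A totally isotropic family and its dual family together are independent.\<close>

lemma totally_isotropic_card:
  assumes ind: "independent S" and iso: "\<And>x y. x \<in> S \<Longrightarrow> y \<in> S \<Longrightarrow> B x y = 0"
  shows "card S \<le> 4"
proof -
  have fin: "finite S" using independent_bound ind by blast
  have "\<exists>y. (\<forall>s\<in>S - {v}. B s y = 0) \<and> B v y = 1" if "v \<in> S" for v
    using polar_separates[of "S - {v}" v] fin that ind by (auto simp: dependent_def)
  then obtain d where d: "\<And>v s. v \<in> S \<Longrightarrow> s \<in> S \<Longrightarrow> B s (d v) = (if s = v then 1 else 0)"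
    by (metis Diff_iff singletonD)
  define b where "b = (\<lambda>(i, v). if i then v else d v)"
  \<comment> \<open>The subtracted sum makes \<open>c (True, w)\<close> orthogonal to every
    \<open>d v\<close>; as a combination of elements of the isotropic set \<open>S\<close> it does
    not affect the pairing with \<open>S\<close>. So \<open>c\<close> is dual to \<open>b\<close>,
    and twice the size of \<open>S\<close> is at most eight.\<close>
  define c where "c = (\<lambda>(i, v). if i then d v - (\<Sum>s\<in>S. B (d v) (d s) \<cdot> s) else v)"
  have Bsum: "B x (\<Sum>s\<in>S. g s \<cdot> s) = (\<Sum>s\<in>S. g s * B x s)" for x g
    using additive.sum[OF additive.intro, of "B x" "\<lambda>s. g s \<cdot> s" S]
    by (simp add: polar_simps)
  have d': "B (d v) s = (if s = v then 1 else 0)" if "v \<in> S" "s \<in> S" for v s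
    using d[OF that] by (simp add: polar_sym)
  have dd: "B (d v) (d w) - (\<Sum>s\<in>S. B (d w) (d s) * B (d v) s) = 0" if "v \<in> S" "w \<in> S" for v w
  proof -
    have "(\<Sum>s\<in>S. B (d w) (d s) * B (d v) s) = (\<Sum>s\<in>S. if s = v then B (d w) (d s) else 0)"
      using that by (intro sum.cong) (auto simp: d')
    also have "\<dots> = B (d v) (d w)"
      using that fin polar_sym by simp
    finally show ?thesis by simp
  qed
  have "B (b (p, v)) (c (q, w)) = (if (p, v) = (q, w) then 1 else 0)"
    if "v \<in> S" "w \<in> S" for p q v w
    using dd[OF that] that
    by (cases p; cases q) (simp_all add: b_def c_def polar_diff_right Bsum iso d d')
  then have "B (b i) (c j) = (if i = j then 1 else 0)" if "i \<in> UNIV \<times> S" "j \<in> UNIV \<times> S" for i j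
    using that by (cases i, cases j) auto
  then have "inj_on b (UNIV \<times> S)" "independent (b ` (UNIV \<times> S))"
    using dual_family_independent[of "UNIV \<times> S" b c] fin by auto
  then have "card (UNIV \<times> S :: (bool \<times> 'a) set) \<le> 8"
    using independent_bound card_image by metis
  then show ?thesis by (simp add: card_cartesian_product)
qed

end

section \<open>Matrix coordinates\<close>

text \<open>Four named entries turn matrix identities into polynomial identities.\<close>

definition mat22 :: "'f \<Rightarrow> 'f \<Rightarrow> 'f \<Rightarrow> 'f \<Rightarrow> 'f::field mat2" where
  "mat22 a b c d = vector [vector [a, b], vector [c, d]]"

lemma mat22_nth [simp]:
  "mat22 a b c d $ 1 $ 1 = a" "mat22 a b c d $ 1 $ 2 = b"
  "mat22 a b c d $ 2 $ 1 = c" "mat22 a b c d $ 2 $ 2 = d"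
  by (simp_all add: mat22_def)

lemma mat22_eq_iff:
  "A = mat22 a b c d \<longleftrightarrow> A $ 1 $ 1 = a \<and> A $ 1 $ 2 = b \<and> A $ 2 $ 1 = c \<and> A $ 2 $ 2 = d"
  by (auto simp: vec_eq_iff forall_2)

lemma mat22_inject [simp]:
  "mat22 a b c d = mat22 a' b' c' d' \<longleftrightarrow> a = a' \<and> b = b' \<and> c = c' \<and> d = d'"
  by (auto simp: mat22_eq_iff)

lemma mat22_cases [cases type]:
  obtains a b c d where "(A :: 'f::field mat2) = mat22 a b c d"
  by (simp add: mat22_eq_iff)

lemma mat22_simps [simp]:
  "mat22 a b c d + mat22 a' b' c' d' = mat22 (a + a') (b + b') (c + c') (d + d')"
  "mat22 a b c d - mat22 a' b' c' d' = mat22 (a - a') (b - b') (c - c') (d - d')"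
  "- mat22 a b c d = mat22 (- a) (- b) (- c) (- d)"
  "mat_scale k (mat22 a b c d) = mat22 (k * a) (k * b) (k * c) (k * d)"
  "adjugate2 (mat22 a b c d) = mat22 d (- b) (- c) a"
  "det (mat22 a b c d) = a * d - b * c"
  "mat22 a b c d ** mat22 a' b' c' d' =
    mat22 (a * a' + b * c') (a * b' + b * d') (c * a' + d * c') (c * b' + d * d')"
  by (simp_all add: mat22_eq_iff mat_scale_def adjugate2_def det_2 matrix_matrix_mult_def sum_2)

lemma mat22_special:
  "0 = mat22 0 0 0 0" "mat r = mat22 r 0 0 r" "p0 = mat22 1 0 0 0" "n0 = mat22 0 1 0 0"
  by (simp_all add: mat22_eq_iff mat_def p0_def n0_def)

lemma polar_std_norm:
  "polar std_norm (mat22 a b c d, mat22 a' b' c' d') (mat22 x y z w, mat22 x' y' z' w') =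
    a * w + d * x - b * z - c * y - (a' * w' + d' * x' - b' * z' - c' * y')"
  by (simp add: polar_def std_norm_def algebra_simps)

lemma vector_space_mat_scale: "vector_space (mat_scale :: 'f::field \<Rightarrow> 'f mat2 \<Rightarrow> 'f mat2)"
  by unfold_locales (simp_all add: mat_scale_def vec_eq_iff algebra_simps)

lemma vector_space_std_scale:
  "vector_space (std_scale :: 'f::field \<Rightarrow> 'f mat2 \<times> 'f mat2 \<Rightarrow> 'f mat2 \<times> 'f mat2)"
  by unfold_locales (simp_all add: std_scale_def mat_scale_def vec_eq_iff algebra_simps prod_eq_iff)

lemma std_scale_Pair [simp]: "std_scale c (a, x) = (mat_scale c a, mat_scale c x)"
  by (simp add: std_scale_def)

definition std_basis :: "nat \<Rightarrow> 'f::field mat2 \<times> 'f mat2" where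
  "std_basis i = [(mat22 1 0 0 0, 0), (mat22 0 1 0 0, 0), (mat22 0 0 1 0, 0), (mat22 0 0 0 1, 0),
     (0, mat22 1 0 0 0), (0, mat22 0 1 0 0), (0, mat22 0 0 1 0), (0, mat22 0 0 0 1)] ! i"

text \<open>The polar form of \<open>std_norm\<close> pairs opposite corners of a matrix. The sign
  is plus on the diagonal and minus off it in the first half, and reversed in the second.\<close>

definition std_dual :: "nat \<Rightarrow> 'f::field mat2 \<times> 'f mat2" where
  "std_dual i = [(mat22 0 0 0 1, 0), (mat22 0 0 (- 1) 0, 0), (mat22 0 (- 1) 0 0, 0),
     (mat22 1 0 0 0, 0), (0, mat22 0 0 0 (- 1)), (0, mat22 0 0 1 0), (0, mat22 0 1 0 0),
     (0, mat22 (- 1) 0 0 0)] ! i"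

lemma less_8: "(i::nat) < 8 \<longleftrightarrow> i \<in> {0, 1, 2, 3, 4, 5, 6, 7}"
  by auto

lemma std_dual: "i < 8 \<Longrightarrow> j < 8 \<Longrightarrow>
    polar std_norm (std_basis i) (std_dual j) = (if i = j then 1 else 0)"
  unfolding less_8 insert_iff empty_iff
  by (elim disjE FalseE; hypsubst; simp add: std_basis_def std_dual_def mat22_special(1) polar_std_norm)

context octonion_algebra
begin

text \<open>Bijectivity follows from preservation of the polar form: the images of
  \<open>std_basis\<close> have a dual family, so they are eight independent vectors and span.
  Pairing with \<open>std_dual\<close> shows that the kernel is zero.\<close>

lemma split_coordinatesI:
  assumes lin: "Vector_Spaces.linear std_scale smul \<phi>"
    and mult: "\<And>u v. \<phi> (std_mult u v) = \<phi> u \<odot> \<phi> v"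
    and norm: "\<And>u. N (\<phi> u) = std_norm u"
  shows "split_coordinates smul mul N \<phi>"
proof -
  interpret \<phi>: Vector_Spaces.linear std_scale smul \<phi> by (rule lin)
  have polar: "B (\<phi> u) (\<phi> v) = polar std_norm u v" for u v
    by (simp add: polar_def norm flip: \<phi>.add)
  have *: "inj_on (\<phi> \<circ> std_basis) {..<8}" "independent ((\<phi> \<circ> std_basis) ` {..<8})"
    using dual_family_independent[of "{..<8}" "\<phi> \<circ> std_basis" "\<phi> \<circ> std_dual"]
    by (auto simp: polar std_dual)
  then have "span ((\<phi> \<circ> std_basis) ` {..<8}) = UNIV"
    by (intro span_independent_8) (auto simp only: card_image card_lessThan)
  moreover have "span ((\<phi> \<circ> std_basis) ` {..<8}) \<subseteq> range \<phi>"
    by (rule span_minimal) (use \<phi>.subspace_image[of UNIV] in auto)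
  ultimately have "surj \<phi>" by blast
  moreover have "inj \<phi>"
  proof (rule \<phi>.inj_iff_eq_0[THEN iffD2], intro allI impI)
    fix u assume "\<phi> u = 0"
    then have 0: "polar std_norm u (std_dual i) = 0" for i
      by (simp add: polar[symmetric] polar_simps)
    obtain a x where u: "u = (a, x)" by (cases u)
    then show "u = 0"
      using 0[of 0] 0[of 1] 0[of 2] 0[of 3] 0[of 4] 0[of 5] 0[of 6] 0[of 7]
      by (cases a; cases x)
        (simp add: zero_prod_def std_dual_def mat22_special(1) polar_std_norm)
  qed
  ultimately show ?thesis
    using assms by (auto simp: split_coordinates_def bij_def)
qed

text \<open>A unital copy of the matrix algebra. Recording the trace suffices to match conjugation
  with the adjugate and the norm with the determinant.\<close>

definition matrix_embedding :: "('f mat2 \<Rightarrow> 'a) \<Rightarrow> bool" where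
  "matrix_embedding \<psi> \<longleftrightarrow> Vector_Spaces.linear mat_scale smul \<psi> \<and>
     (\<forall>a b. \<psi> (a ** b) = \<psi> a \<odot> \<psi> b) \<and> \<psi> (mat 1) = e \<and> (\<forall>a. T (\<psi> a) = a $ 1 $ 1 + a $ 2 $ 2)"

lemma matrix_embedding_simps:
  assumes "matrix_embedding \<psi>"
  shows "\<psi> (a + b) = \<psi> a + \<psi> b" "\<psi> (mat_scale c a) = c \<cdot> \<psi> a" "\<psi> (a ** b) = \<psi> a \<odot> \<psi> b"
    and "\<psi> (adjugate2 a) = bar (\<psi> a)" "N (\<psi> a) = det a"
proof -
  interpret Vector_Spaces.linear mat_scale smul \<psi>
    using assms by (simp add: matrix_embedding_def)
  show add: "\<psi> (a + b) = \<psi> a + \<psi> b" by (rule add)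
  show scale: "\<psi> (mat_scale c a) = c \<cdot> \<psi> a" for c a by (rule scale)
  show mult: "\<psi> (a ** b) = \<psi> a \<odot> \<psi> b" for a b
    using assms by (simp add: matrix_embedding_def)
  have one: "\<psi> (mat 1) = e" and tr: "T (\<psi> a) = a $ 1 $ 1 + a $ 2 $ 2"
    using assms by (auto simp: matrix_embedding_def)
  have "adjugate2 a = mat_scale (a $ 1 $ 1 + a $ 2 $ 2) (mat 1) - a"
    by (cases a) (simp add: mat22_special)
  then show adj: "\<psi> (adjugate2 a) = bar (\<psi> a)"
    by (simp add: diff scale one bar_def tr)
  have "a ** adjugate2 a = mat_scale (det a) (mat 1)"
    by (cases a) (simp add: mat22_special algebra_simps)
  then have "N (\<psi> a) \<cdot> e = det a \<cdot> e"
    using mul_bar[of "\<psi> a"] by (metis adj mult scale one)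
  then show "N (\<psi> a) = det a"
    by (simp add: e_nonzero)
qed

text \<open>Here \<open>z\<close> plays the role of \<open>w\<close>, and the doubling rules
  reproduce \<open>std_mult\<close>. The norm splits because adjointness turns
  \<open>B (\<psi> a) (\<psi> x \<odot> z)\<close> into a pairing of \<open>z\<close> with a
  matrix.\<close>

lemma doubling_coordinates:
  assumes \<psi>: "matrix_embedding \<psi>" and orth: "\<And>a. B z (\<psi> a) = 0" and z: "N z = - 1"
  shows "split_coordinates smul mul N (\<lambda>(a, x). \<psi> a + \<psi> x \<odot> z)" (is "split_coordinates _ _ _ ?\<phi>")
proof (rule split_coordinatesI)
  note \<psi>_simps = matrix_embedding_simps[OF \<psi>]
  have Tz: "B z e = 0"
    using orth[of "mat 1"] \<psi> by (simp add: matrix_embedding_def)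
  note dbl = cayley_dickson_doubling[OF e_nonzero Tz orth orth]
  show "Vector_Spaces.linear std_scale smul ?\<phi>"
    unfolding Vector_Spaces.linear_iff
    using vector_space_std_scale vector_space_axioms
    by (auto simp: \<psi>_simps alg_simps algebra_simps)
  show "?\<phi> (std_mult u v) = ?\<phi> u \<odot> ?\<phi> v" for u v
  proof -
    obtain a x b y where u: "u = (a, x)" and v: "v = (b, y)" by (metis surj_pair)
    have 0: "B z (\<psi> c \<odot> \<psi> d) = 0" for c d
      using orth[of "c ** d"] by (simp add: \<psi>_simps)
    show ?thesis
      by (simp add: u v \<psi>_simps alg_simps dbl 0 z algebra_simps)
  qed
  show "N (?\<phi> u) = std_norm u" for u
  proof -
    obtain a x where u: "u = (a, x)" by (metis surj_pair)
    have "B (\<psi> a) (\<psi> x \<odot> z) = B z (\<psi> (adjugate2 x ** a))"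
      by (simp add: polar_sym[of "\<psi> a"] polar_mul_left \<psi>_simps)
    also have "\<dots> = 0" by (rule orth)
    finally show ?thesis
      by (simp add: u norm_add norm_mult \<psi>_simps z std_norm_def)
  qed
qed

text \<open>The pair \<open>u\<close>, \<open>u'\<close> supplies the off-diagonal matrix units.
  Their two products are the diagonal idempotents, which add up to \<open>e\<close> by the
  normalization \<open>B u u' = - 1\<close>.\<close>

lemma hyperbolic_pair_embedding:
  assumes u: "T u = 0" "N u = 0" and u': "T u' = 0" "N u' = 0" and uu': "B u u' = - 1"
  shows "matrix_embedding (\<lambda>a. (a $ 1 $ 1) \<cdot> (u \<odot> u') + (a $ 1 $ 2) \<cdot> u + (a $ 2 $ 1) \<cdot> u' +
           (a $ 2 $ 2) \<cdot> (u' \<odot> u))" (is "matrix_embedding ?\<psi>")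
proof -
  define p where "p = u \<odot> u'"
  define q where "q = u' \<odot> u"
  have q: "q = e - p"
    using mul_swap[of u u'] assms by (simp add: p_def q_def algebra_simps)
  have uu: "u \<odot> u = 0" "u' \<odot> u' = 0"
    using assms by (simp_all add: square)
  have "u \<odot> p = 0" "p \<odot> u' = 0"
    unfolding p_def by (simp_all add: left_alternative right_alternative uu alg_simps)
  moreover have uq: "u \<odot> q = u" "q \<odot> u' = u'"
    using calculation by (simp_all add: q alg_simps)
  moreover have "u' \<odot> q = 0" "q \<odot> u = 0"
    unfolding q_def by (simp_all add: left_alternative right_alternative uu alg_simps)
  moreover have "p \<odot> u = u" "u' \<odot> p = u'"
    using calculation by (simp_all add: q alg_simps)
  moreover have Tp: "T p = 1" "T q = 1"
    using assms by (simp_all add: p_def q_def T_mul bar_def polar_simps polar_sym[of u' u])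
  moreover have "N p = 0"
    using assms by (simp add: p_def norm_mult)
  then have "p \<odot> p = p"
    by (simp add: square Tp)
  moreover have "p \<odot> q = 0" "q \<odot> p = 0" "q \<odot> q = q"
    using \<open>p \<odot> p = p\<close> by (simp_all add: q alg_simps)
  moreover have "u \<odot> u' = p" "u' \<odot> u = q"
    by (simp_all add: p_def q_def)
  ultimately have table: "u \<odot> p = 0" "p \<odot> u' = 0" "u \<odot> q = u" "q \<odot> u' = u'" "u' \<odot> q = 0" "q \<odot> u = 0"
    "p \<odot> u = u" "u' \<odot> p = u'" "p \<odot> p = p" "p \<odot> q = 0" "q \<odot> p = 0" "q \<odot> q = q"
    "u \<odot> u' = p" "u' \<odot> u = q" by auto
  have "Vector_Spaces.linear mat_scale smul ?\<psi>"
    unfolding Vector_Spaces.linear_iff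
    using vector_space_mat_scale vector_space_axioms
    by (auto simp: mat_scale_def algebra_simps)
  moreover have "?\<psi> (a ** b) = ?\<psi> a \<odot> ?\<psi> b" for a b
    by (cases a; cases b) (simp add: table uu alg_simps algebra_simps)
  moreover have "?\<psi> (mat 1) = e"
    by (simp add: mat22_special table) (simp add: q)
  moreover have "T (?\<psi> a) = a $ 1 $ 1 + a $ 2 $ 2" for a
    using assms Tp by (simp add: polar_simps table)
  ultimately show ?thesis
    by (simp add: matrix_embedding_def)
qed

lemma ex_nonnull_orthogonal:
  assumes \<psi>: "matrix_embedding \<psi>"
  shows "\<exists>z. (\<forall>a. B z (\<psi> a) = 0) \<and> N z \<noteq> 0"
proof -
  note \<psi>_simps = matrix_embedding_simps[OF \<psi>]
  have B\<psi>: "B (\<psi> a) (\<psi> b) = det (a + b) - det a - det b" for a b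
    by (simp add: polar_def \<psi>_simps flip: \<psi>_simps(1))
  define E1 E2 E3 E4 where E: "E1 = \<psi> (mat22 1 0 0 0)" "E2 = \<psi> (mat22 0 1 0 0)"
    "E3 = \<psi> (mat22 0 0 1 0)" "E4 = \<psi> (mat22 0 0 0 1)"
  have \<psi>_expand: "\<psi> a = (a $ 1 $ 1) \<cdot> E1 + (a $ 1 $ 2) \<cdot> E2 + (a $ 2 $ 1) \<cdot> E3 + (a $ 2 $ 2) \<cdot> E4" for a
    by (cases a) (simp add: E flip: \<psi>_simps)
  have BE: "B E1 E1 = 0" "B E1 E2 = 0" "B E1 E3 = 0" "B E1 E4 = 1"
    "B E2 E1 = 0" "B E2 E2 = 0" "B E2 E3 = - 1" "B E2 E4 = 0"
    "B E3 E1 = 0" "B E3 E2 = - 1" "B E3 E3 = 0" "B E3 E4 = 0"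
    "B E4 E1 = 1" "B E4 E2 = 0" "B E4 E3 = 0" "B E4 E4 = 0"
    by (simp_all add: E B\<psi>)
  \<comment> \<open>The orthogonal projection onto the complement of the matrices:
    \<open>E4\<close>, \<open>- E3\<close>, \<open>- E2\<close>, \<open>E1\<close> are dual to
    \<open>E1\<close>, \<open>E2\<close>, \<open>E3\<close>, \<open>E4\<close>.\<close>
  define proj where
    "proj x = x - B x E4 \<cdot> E1 + B x E3 \<cdot> E2 + B x E2 \<cdot> E3 - B x E1 \<cdot> E4" for x
  have orth: "B (proj x) (\<psi> a) = 0" for x a
    by (simp add: proj_def \<psi>_expand polar_simps BE)
  have orth': "B (proj x) E1 = 0" "B (proj x) E2 = 0" "B (proj x) E3 = 0" "B (proj x) E4 = 0" for x
    using orth by (simp_all add: E)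
  have "card {E1, E2, E3, E4} \<le> 4"
    by (simp add: card_insert_if)
  then obtain v where v: "v \<notin> span {E1, E2, E3, E4}"
    using ex_notin_span[of "{E1, E2, E3, E4}"] by auto
  have "proj v \<noteq> 0"
  proof
    assume "proj v = 0"
    then have "v = B v E4 \<cdot> E1 - B v E3 \<cdot> E2 - B v E2 \<cdot> E3 + B v E1 \<cdot> E4"
      by (simp add: proj_def algebra_simps eq_neg_iff_add_eq_0)
    also have "\<dots> \<in> span {E1, E2, E3, E4}"
      by (intro span_add span_diff span_scale span_base) auto
    finally show False using v by blast
  qed
  then obtain y where "B (proj v) y \<noteq> 0"
    using nondegenerate by blast
  moreover have "B (proj v) (proj y) = B (proj v) y"
    unfolding proj_def[of y] by (simp add: polar_simps orth')
  \<comment> \<open>If all three norms vanished, so would \<open>B (proj v) (proj y)\<close>; this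
    argument is valid in characteristic two as well.\<close>
  ultimately have "N (proj v + proj y) \<noteq> 0 \<or> N (proj v) \<noteq> 0 \<or> N (proj y) \<noteq> 0"
    by (auto simp: norm_add)
  moreover have "B (proj v + proj y) (\<psi> a) = 0" for a
    by (simp add: polar_simps orth)
  ultimately show ?thesis
    using orth by blast
qed

lemma hyperbolic_pair_coordinates:
  assumes u: "T u = 0" "N u = 0" and u': "T u' = 0" "N u' = 0" and uu': "B u u' = - 1"
  shows "\<exists>\<phi>. split_coordinates smul mul N \<phi> \<and> \<phi> (n0, 0) = u \<and> \<phi> (mat22 0 0 1 0, 0) = u'"
proof -
  define \<psi> where "\<psi> a = (a $ 1 $ 1) \<cdot> (u \<odot> u') + (a $ 1 $ 2) \<cdot> u + (a $ 2 $ 1) \<cdot> u' +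
           (a $ 2 $ 2) \<cdot> (u' \<odot> u)" for a :: "'f mat2"
  have \<psi>: "matrix_embedding \<psi>"
    using hyperbolic_pair_embedding[OF assms] by (simp add: \<psi>_def[abs_def])
  note \<psi>_simps = matrix_embedding_simps[OF \<psi>]
  obtain z where z: "\<And>a. B z (\<psi> a) = 0" "N z \<noteq> 0"
    using ex_nonnull_orthogonal[OF \<psi>] by blast
  \<comment> \<open>As \<open>det m = - inverse (N z)\<close>, multiplication by
    \<open>\<psi> m\<close> normalizes the norm of \<open>z\<close> to \<open>- 1\<close>; the
    product stays orthogonal to the matrices.\<close>
  define m where "m = mat22 (- inverse (N z)) 0 0 1"
  have "B (\<psi> m \<odot> z) (\<psi> a) = 0" for a
    using z(1)[of "adjugate2 m ** a"] by (simp add: polar_mul_left \<psi>_simps)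
  moreover have "N (\<psi> m \<odot> z) = - 1"
    using z(2) by (simp add: norm_mult \<psi>_simps m_def)
  ultimately have "split_coordinates smul mul N (\<lambda>(a, x). \<psi> a + \<psi> x \<odot> (\<psi> m \<odot> z))"
    by (rule doubling_coordinates[OF \<psi>])
  moreover have "\<psi> n0 = u" "\<psi> (mat22 0 0 1 0) = u'" "\<psi> 0 = 0"
    by (simp_all add: \<psi>_def mat22_special)
  ultimately show ?thesis
    by (intro exI[of _ "\<lambda>(a, x). \<psi> a + \<psi> x \<odot> (\<psi> m \<odot> z)"]) (simp add: alg_simps)
qed

end

section \<open>Adapted split coordinates\<close>

lemma matrix_add_rdistrib: "(A + B) ** C = A ** C + B ** C"
  by (vector matrix_matrix_mult_def sum.distrib[symmetric] field_simps)

lemma adjugate2_mult: "adjugate2 (a ** b) = adjugate2 b ** adjugate2 a"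
  by (cases a; cases b) (simp add: algebra_simps)

lemma adjugate2_adjugate2 [simp]: "adjugate2 (adjugate2 a) = a"
  by (cases a) simp

lemma mult_adjugate2: "a ** adjugate2 a = mat (det a)" "adjugate2 a ** a = mat (det a)"
  by (cases a; simp add: mat22_special algebra_simps)+

lemma det_adjugate2 [simp]: "det (adjugate2 a) = det (a :: 'f::field mat2)"
  by (cases a) (simp add: algebra_simps)

text \<open>For \<open>det g = det m = 1\<close> the adjugates are inverses, and this is an
  automorphism of the split octonions that preserves both halves.\<close>

definition std_twist ::
    "'f::field mat2 \<Rightarrow> 'f mat2 \<Rightarrow> 'f mat2 \<times> 'f mat2 \<Rightarrow> 'f mat2 \<times> 'f mat2" where
  "std_twist g m u = (g ** fst u ** adjugate2 g, m ** snd u ** adjugate2 g)"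

lemma std_twist_mult:
  assumes "det g = 1" "det m = 1"
  shows "std_twist g m (std_mult u v) = std_mult (std_twist g m u) (std_twist g m v)"
proof -
  obtain a x b y where uv: "u = (a, x)" "v = (b, y)" by (metis surj_pair)
  have g: "adjugate2 g ** (g ** c) = c" "adjugate2 m ** (m ** c) = c" for c
    using assms by (simp_all add: matrix_mul_assoc mult_adjugate2)
  show ?thesis
    by (simp add: uv std_twist_def adjugate2_mult matrix_add_ldistrib matrix_add_rdistrib
        matrix_mul_assoc[symmetric] g)
qed

lemma std_twist_linear: "Vector_Spaces.linear std_scale std_scale (std_twist g m)"
  unfolding Vector_Spaces.linear_iff
proof (intro conjI allI vector_space_std_scale)
  fix u v :: "'a mat2 \<times> 'a mat2" and c
  show "std_twist g m (u + v) = std_twist g m u + std_twist g m v"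
    by (simp add: std_twist_def matrix_add_ldistrib matrix_add_rdistrib)
  obtain a x where u: "u = (a, x)" by (metis surj_pair)
  show "std_twist g m (std_scale c u) = std_scale c (std_twist g m u)"
    by (cases a; cases x; cases g; cases m) (simp add: u std_twist_def algebra_simps)
qed

lemma std_twist_norm: "det g = 1 \<Longrightarrow> det m = 1 \<Longrightarrow> std_norm (std_twist g m u) = std_norm u"
  by (simp add: std_norm_def std_twist_def det_mul)

context octonion_algebra
begin

lemma split_coordinatesD:
  assumes "split_coordinates smul mul N \<phi>"
  shows "Vector_Spaces.linear std_scale smul \<phi>" "inj \<phi>" "surj \<phi>"
    and "\<phi> (u + v) = \<phi> u + \<phi> v" "\<phi> (std_scale c u) = c \<cdot> \<phi> u" "\<phi> 0 = 0" "\<phi> (u - v) = \<phi> u - \<phi> v"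
    and "\<phi> (std_mult u v) = \<phi> u \<odot> \<phi> v" "N (\<phi> u) = std_norm u"
    and "B (\<phi> u) (\<phi> v) = polar std_norm u v"
    and "\<phi> (mat 1, 0) = e" "T (\<phi> (a, x)) = a $ 1 $ 1 + a $ 2 $ 2"
proof -
  show lin: "Vector_Spaces.linear std_scale smul \<phi>" and "inj \<phi>" and surj: "surj \<phi>"
    and mult: "\<phi> (std_mult u v) = \<phi> u \<odot> \<phi> v" and norm: "N (\<phi> u) = std_norm u" for u v
    using assms unfolding split_coordinates_def bij_def by blast+
  interpret Vector_Spaces.linear std_scale smul \<phi> by (rule lin)
  show add: "\<phi> (u + v) = \<phi> u + \<phi> v" and "\<phi> (std_scale c u) = c \<cdot> \<phi> u"
    and "\<phi> 0 = 0" and "\<phi> (u - v) = \<phi> u - \<phi> v" for u v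
    by (rule add scale zero diff)+
  show polar: "B (\<phi> u) (\<phi> v) = polar std_norm u v" for u v
    by (simp add: polar_def norm flip: add)
  obtain a x where "\<phi> (a, x) = e"
    using surj by (metis surj_pair surjD)
  moreover have "std_mult (mat 1, 0) (a, x) = (a, x)"
    by (cases a; cases x) (simp add: mat22_special)
  ultimately show one: "\<phi> (mat 1, 0) = e"
    by (metis mult mult_e_right)
  show "T (\<phi> (a, x)) = a $ 1 $ 1 + a $ 2 $ 2" for a x
    by (cases a; cases x) (simp add: one[symmetric] polar mat22_special polar_std_norm)
qed

lemma split_coordinates_twist:
  assumes "split_coordinates smul mul N \<phi>" "det g = 1" "det m = 1"
  shows "split_coordinates smul mul N (\<phi> \<circ> std_twist g m)"
proof (rule split_coordinatesI)
  show "Vector_Spaces.linear std_scale smul (\<phi> \<circ> std_twist g m)"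
    using std_twist_linear split_coordinatesD(1)[OF assms(1)] by (rule Vector_Spaces.linear_compose)
qed (use assms in \<open>simp_all add: split_coordinatesD[OF assms(1)] std_twist_mult std_twist_norm
  del: std_mult.simps\<close>)

text \<open>The automorphism is \<open>\<phi>' \<circ> inv \<phi>\<close>. Membership in an orbit
  thus reduces to finding coordinates that carry the model onto the given set.\<close>

lemma split_coordinates_aut:
  assumes \<phi>: "split_coordinates smul mul N \<phi>" and \<phi>': "split_coordinates smul mul N \<phi>'"
  shows "\<phi>' ` X \<in> aut_orbit smul mul (\<phi> ` X)"
proof -
  note D = split_coordinatesD[OF \<phi>] and D' = split_coordinatesD[OF \<phi>']
  define f where "f = \<phi>' \<circ> inv \<phi>"
  have f: "f (\<phi> u) = \<phi>' u" for u
    using D(2) by (simp add: f_def)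
  have "Vector_Spaces.linear smul smul f"
    unfolding Vector_Spaces.linear_iff
  proof (intro conjI allI vector_space_axioms)
    fix x y c
    obtain u v where "x = \<phi> u" "y = \<phi> v" using D(3) by (metis surjD)
    then show "f (x + y) = f x + f y" "f (c \<cdot> x) = c \<cdot> f x"
      by (simp_all add: f D' flip: D(4,5))
  qed
  moreover have "bij f"
    unfolding f_def by (intro bij_comp bij_imp_bij_inv bijI D(2,3) D'(2,3))
  moreover have "f (x \<odot> y) = f x \<odot> f y" for x y
  proof -
    obtain u v where "x = \<phi> u" "y = \<phi> v" using D(3) by (metis surjD)
    then show ?thesis by (simp add: f D'(8) flip: D(8))
  qed
  ultimately have "f \<in> algebra_aut smul mul"
    by (simp add: algebra_aut_def)
  moreover have "\<phi>' ` X = f ` \<phi> ` X"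
    by (simp add: image_image f)
  ultimately show ?thesis
    unfolding aut_orbit_def by blast
qed

lemma commutative_orbit:
  assumes \<phi>: "split_coordinates smul mul N \<phi>" and X: "commutative_on std_mult X"
    and A: "A \<in> aut_orbit smul mul (\<phi> ` X)"
  shows "commutative_on mul A"
proof -
  obtain f where f: "f \<in> algebra_aut smul mul" and A: "A = f ` \<phi> ` X"
    using A by (auto simp: aut_orbit_def)
  have "f (\<phi> u) \<odot> f (\<phi> v) = f (\<phi> (std_mult u v))" for u v
    using f by (simp add: algebra_aut_def split_coordinatesD(8)[OF \<phi>])
  moreover have "std_mult u v = std_mult v u" if "u \<in> X" "v \<in> X" for u v
    using X that by (simp add: commutative_on_def)
  ultimately have "f (\<phi> u) \<odot> f (\<phi> v) = f (\<phi> v) \<odot> f (\<phi> u)" if "u \<in> X" "v \<in> X" for u v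
    using that by simp
  then show ?thesis
    by (auto simp: A commutative_on_def)
qed

section \<open>Hyperbolic partners and coordinates adapted to null elements\<close>

lemma ex_hyperbolic_partner:
  assumes "finite S" "u \<notin> span S" "N u = 0" and orth: "\<And>s. s \<in> S \<Longrightarrow> B s u = 0"
  shows "\<exists>u'. N u' = 0 \<and> B u u' = - 1 \<and> (\<forall>s\<in>S. B s u' = 0)"
proof -
  obtain y where y: "\<forall>s\<in>S. B s y = 0" "B u y = 1"
    using polar_separates assms by blast
  \<comment> \<open>Since \<open>u\<close> is null and \<open>B u y = 1\<close>, the norm of
    \<open>c \<cdot> u - y\<close> is \<open>N y - c\<close>, which vanishes for
    \<open>c = N y\<close>.\<close>
  have "N (N y \<cdot> u - y) = 0"
    using norm_add[of "N y \<cdot> u" "- y"] y assms by (simp add: norm_scale norm_minus polar_simps)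
  moreover have "B u (N y \<cdot> u - y) = - 1" "\<forall>s\<in>S. B s (N y \<cdot> u - y) = 0"
    using y assms by (simp_all add: polar_simps polar_self)
  ultimately show ?thesis by blast
qed

lemma null_notin_span_e:
  assumes "N u = 0" "u \<noteq> 0"
  shows "u \<notin> span {e}"
  using assms by (auto simp: span_singleton norm_scale N_e)

lemma null_trace_zero_coordinates:
  assumes "u \<noteq> 0" "N u = 0" "T u = 0"
  shows "\<exists>\<phi>. split_coordinates smul mul N \<phi> \<and> \<phi> (n0, 0) = u"
proof -
  obtain u' where "N u' = 0" "B u u' = - 1" "T u' = 0"
    using ex_hyperbolic_partner[of "{e}" u] null_notin_span_e assms by (auto simp: polar_sym)
  then show ?thesis
    using hyperbolic_pair_coordinates assms by blast
qed

lemma split_coordinates_exist: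
  assumes "is_split N"
  shows "\<exists>\<phi>. split_coordinates smul mul N \<phi>"
proof -
  obtain x where x: "x \<noteq> 0" "N x = 0"
    using assms by (auto simp: is_split_def)
  have "\<exists>u. u \<noteq> 0 \<and> N u = 0 \<and> T u = 0"
  proof (cases "T x = 0")
    case False
    have "card {e, x} < 8" by (simp add: card_insert_if)
    then obtain v where v: "v \<notin> span {e, x}"
      using ex_notin_span[of "{e, x}"] by auto
    \<comment> \<open>The condition on \<open>v\<close> makes \<open>y\<close> non-zero. Either
      \<open>x \<odot> y\<close> is a non-zero null element of trace zero, or it vanishes and
      \<open>y\<close> itself is null.\<close>
    then obtain y where y: "T y = 0" "B x y = 0" "B v y = 1"
      using polar_separates[of "{e, x}" v] polar_sym by auto
    have "y \<noteq> 0"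
      using y by (auto simp: polar_zero_right)
    have "N y \<cdot> x = (x \<odot> y) \<odot> bar y"
      by (simp add: mul_bar_cancel)
    then have "N y = 0" if "x \<odot> y = 0"
      using that x by (simp add: mul_zero_left)
    moreover have "N (x \<odot> y) = 0" "T (x \<odot> y) = 0"
      using x y by (simp_all add: norm_mult T_mul bar_def polar_simps)
    ultimately show ?thesis
      using \<open>y \<noteq> 0\<close> y by blast
  qed (use x in blast)
  then show ?thesis
    using null_trace_zero_coordinates by blast
qed

text \<open>The target relation is that \<open>n0\<close> times \<open>p0 w\<close> is
  \<open>n0 w\<close>. A hyperbolic partner of \<open>x\<close> orthogonal to \<open>e\<close>,
  \<open>y\<close> and \<open>x \<odot> y\<close> gives coordinates in which \<open>x\<close> is
  \<open>n0\<close> and \<open>y\<close> lies in the second half; a twist then normalizes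
  \<open>y\<close>.\<close>

lemma heisenberg_coordinates:
  assumes x: "N x = 0" "T x = 0" and y: "N y = 0" "T y = 0"
    and xy: "B x y = 0" and nz: "x \<odot> y \<noteq> 0"
  shows "\<exists>\<phi>. split_coordinates smul mul N \<phi> \<and> \<phi> (n0, 0) = x \<and> \<phi> (0, p0) = y \<and> \<phi> (0, n0) = x \<odot> y"
proof -
  have xx: "x \<odot> x = 0" and yy: "y \<odot> y = 0"
    using x y by (simp_all add: square)
  \<comment> \<open>Multiplying a relation by \<open>y\<close> on the right leaves
    \<open>x \<odot> y = a \<cdot> y\<close>. Multiplying this by \<open>x\<close> on the left gives
    \<open>a \<cdot> (x \<odot> y) = 0\<close>, so \<open>x \<odot> y\<close> would vanish.\<close>
  have "x \<notin> span {e, y, x \<odot> y}"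
  proof
    assume "x \<in> span {e, y, x \<odot> y}"
    then obtain a b c where *: "x = a \<cdot> e + (b \<cdot> y + c \<cdot> (x \<odot> y))"
      by (auto simp: span_insert span_empty algebra_simps eq_diff_eq)
    have "x \<odot> y = (a \<cdot> e + (b \<cdot> y + c \<cdot> (x \<odot> y))) \<odot> y"
      using * by simp
    also have "\<dots> = a \<cdot> y"
      by (simp add: alg_simps yy right_alternative)
    finally have a: "x \<odot> y = a \<cdot> y" .
    have "x \<odot> (x \<odot> y) = 0"
      by (simp add: left_alternative xx alg_simps)
    then have "a \<cdot> (x \<odot> y) = 0"
      by (simp add: a mul_scale_right)
    then show False
      using nz a by simp
  qed
  moreover have "B (x \<odot> y) x = 0"
    using x y by (simp add: polar_mul_left bar_mul polar_simps)
  then have "B s x = 0" if "s \<in> {e, y, x \<odot> y}" for s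
    using that x xy polar_sym by auto
  ultimately obtain x' where x': "N x' = 0" "B x x' = - 1" "B e x' = 0" "B y x' = 0" "B (x \<odot> y) x' = 0"
    using ex_hyperbolic_partner[of "{e, y, x \<odot> y}" x] x by auto
  have Tx': "T x' = 0"
    using x' polar_sym by metis
  obtain \<phi> where \<phi>: "split_coordinates smul mul N \<phi>" and \<phi>_x: "\<phi> (n0, 0) = x" "\<phi> (mat22 0 0 1 0, 0) = x'"
    using hyperbolic_pair_coordinates x x' Tx' by metis
  note D = split_coordinatesD[OF \<phi>]
  have "B (x \<odot> x') y = - B x' (x \<odot> y)"
    using x by (simp add: polar_mul_left bar_def alg_simps polar_simps)
  then have "B (x \<odot> x') y = 0"
    using x' polar_sym by simp
  moreover have "\<phi> (mat22 1 0 0 0, 0) = x \<odot> x'"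
    unfolding \<phi>_x[symmetric] D(8)[symmetric] by (simp add: mat22_special)
  ultimately have 0: "B (\<phi> (mat22 1 0 0 0, 0)) y = 0" "B (\<phi> (n0, 0)) y = 0"
     "B (\<phi> (mat22 0 0 1 0, 0)) y = 0" "T y = 0"
    using \<phi>_x xy y x' by (simp_all add: polar_sym)
  obtain a k where ak: "y = \<phi> (a, k)"
    using D(3) by (metis surj_pair surjD)
  \<comment> \<open>Three matrix units and \<open>e\<close> span the first half, so \<open>y\<close>
    is orthogonal to all of it.\<close>
  have a: "a = 0"
    using 0 unfolding ak D
    by (cases a; cases k) (simp add: mat22_special polar_std_norm)
  obtain s sb t tb where k: "k = mat22 s sb t tb"
    by (rule mat22_cases)
  have det: "s * tb = sb * t"
    using y by (simp add: ak D a k std_norm_def mat22_special)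
  have "x \<odot> y = \<phi> (std_mult (n0, 0) (0, k))"
    by (simp add: ak a D(8) \<phi>_x del: std_mult.simps)
  then have xy_k: "x \<odot> y = \<phi> (0, mat22 0 s 0 t)"
    by (simp add: k mat22_special)
  then have st: "s \<noteq> 0 \<or> t \<noteq> 0"
    using nz D(6) by (auto simp: mat22_special zero_prod_def)
  \<comment> \<open>A twist by \<open>m\<close> and a unipotent \<open>g\<close> commuting with \<open>n0\<close> fixes \<open>n0\<close> and moves \<open>p0 w\<close> to \<open>k w\<close>.\<close>
  have "\<exists>m \<mu>. det m = 1 \<and> k = m ** p0 ** adjugate2 (mat22 1 \<mu> 0 1)"
  \<comment> \<open>As \<open>det k = 0\<close>, the second column of \<open>k\<close> is a multiple
    of the first, which determines \<open>\<mu>\<close>. The first column of \<open>m\<close> is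
    that of \<open>k\<close>, completed to determinant one.\<close>
  proof (cases "s = 0")
    case True
    then show ?thesis
      using st det
      by (intro exI[of _ "mat22 0 (- inverse t) t 0"] exI[of _ "- tb / t"])
        (simp add: k mat22_special)
  next
    case False
    then show ?thesis
      using det
      by (intro exI[of _ "mat22 s 0 t (inverse s)"] exI[of _ "- sb / s"])
        (simp add: k mat22_special field_simps)
  qed
  then obtain m \<mu> where m: "det m = 1" "k = m ** p0 ** adjugate2 (mat22 1 \<mu> 0 1)"
    by blast
  define \<phi>' where "\<phi>' = \<phi> \<circ> std_twist (mat22 1 \<mu> 0 1) m"
  have \<phi>': "split_coordinates smul mul N \<phi>'"
    unfolding \<phi>'_def using \<phi> m by (intro split_coordinates_twist) auto
  have "\<phi>' (0, p0) = y"
    using m by (simp add: \<phi>'_def std_twist_def ak a)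
  moreover have "\<phi>' (n0, 0) = x"
    by (cases m) (simp add: \<phi>'_def std_twist_def \<phi>_x(1)[symmetric] mat22_special)
  moreover have "std_mult (n0, 0) (0, p0 :: 'f mat2) = (0, n0)"
    by (simp add: mat22_special)
  ultimately show ?thesis
    using \<phi>' split_coordinatesD(8)[OF \<phi>', of "(n0, 0)" "(0, p0)"] by auto
qed

text \<open>It suffices to find \<open>x\<close> with \<open>x \<odot> u = v\<close> to which the preceding lemma applies.\<close>

lemma null_algebra_coordinates:
  assumes u: "u \<noteq> 0" "N u = 0" "T u = 0" and v: "N v = 0" "T v = 0"
    and ind: "\<And>c. v \<noteq> c \<cdot> u" and uv: "u \<odot> v = 0"
  shows "\<exists>\<phi>. split_coordinates smul mul N \<phi> \<and> \<phi> (0, p0) = u \<and> \<phi> (0, n0) = v"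
proof -
  obtain \<phi> where \<phi>: "split_coordinates smul mul N \<phi>" and \<phi>_u: "\<phi> (n0, 0) = u"
    using null_trace_zero_coordinates u by metis
  note D = split_coordinatesD[OF \<phi>]
  obtain a k where ak: "v = \<phi> (a, k)"
    using D(3) by (metis surj_pair surjD)
  have "\<phi> (std_mult (n0, 0) (a, k)) = \<phi> 0"
    using uv by (simp add: D(6,8) \<phi>_u ak del: std_mult.simps)
  then have 0: "std_mult (n0, 0) (a, k) = 0"
    using D(2) by (simp add: inj_eq del: std_mult.simps)
  obtain q s t where a: "a = mat22 0 q 0 0" and k: "k = mat22 0 s 0 t"
    \<comment> \<open>The vanishing product kills the second row of \<open>a\<close> and the first
      column of \<open>k\<close>; trace zero kills the remaining diagonal entry of
      \<open>a\<close>.\<close>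
    using 0 v by (cases a; cases k) (simp add: ak D mat22_special zero_prod_def)
  have st: "s \<noteq> 0 \<or> t \<noteq> 0"
  proof (rule ccontr)
    assume "\<not> ?thesis"
    then have "(a, k) = std_scale q (n0, 0)"
      by (simp add: a k mat22_special)
    then show False
      using ind[of q] by (metis D(5) ak \<phi>_u)
  qed
  have "\<exists>r w. q\<^sup>2 = s * w - t * r"
  proof (cases "s = 0")
    case True
    then show ?thesis using st by (intro exI[of _ "- q\<^sup>2 / t"] exI[of _ 0]) simp
  next
    case False
    then show ?thesis by (intro exI[of _ 0] exI[of _ "q\<^sup>2 / s"]) simp
  qed
  then obtain r w where rw: "q\<^sup>2 = s * w - t * r" by blast
  \<comment> \<open>The entries \<open>r\<close> and \<open>w\<close> do not enter the product of
    \<open>x\<close> with \<open>u\<close>, so they can be spent on making \<open>x\<close> null: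
    \<open>N x = - q\<^sup>2 + s * w - t * r\<close>.\<close>
  define x where "x = \<phi> (mat22 q 0 0 (- q), mat22 (- s) r (- t) w)"
  have "N x = 0" "T x = 0" "B x u = 0"
    using rw by (simp_all add: x_def D polar_std_norm mat22_special std_norm_def power2_eq_square
        algebra_simps flip: \<phi>_u)
  moreover have "x \<odot> u = v"
    unfolding x_def \<phi>_u[symmetric] ak a k D(8)[symmetric] by (simp add: mat22_special)
  moreover have "v \<noteq> 0"
    using ind[of 0] by simp
  ultimately show ?thesis
    using heisenberg_coordinates[of x u] u by auto
qed

section \<open>Commutative subalgebras\<close>

lemma in_span_1: "x \<in> span {a} \<Longrightarrow> \<exists>r. x = r \<cdot> a"
  by (auto simp: span_singleton)

lemma in_span_2:
  assumes "x \<in> span {a, b}"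
  shows "\<exists>r s. x = r \<cdot> a + s \<cdot> b"
proof -
  obtain r where "x - r \<cdot> a \<in> span {b}"
    using assms span_breakdown_eq by blast
  then obtain s where "x - r \<cdot> a = s \<cdot> b"
    using in_span_1 by blast
  then have "x = r \<cdot> a + s \<cdot> b"
    by (simp add: diff_eq_eq add.commute)
  then show ?thesis by blast
qed

lemma in_span_3:
  assumes "x \<in> span {a, b, c}"
  shows "\<exists>r s t. x = r \<cdot> a + s \<cdot> b + t \<cdot> c"
proof -
  obtain r where "x - r \<cdot> a \<in> span {b, c}"
    using assms span_breakdown_eq by blast
  then obtain s t where "x - r \<cdot> a = s \<cdot> b + t \<cdot> c"
    using in_span_2 by blast
  then have "x = r \<cdot> a + s \<cdot> b + t \<cdot> c"
    by (simp add: diff_eq_eq ac_simps)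
  then show ?thesis by blast
qed

text \<open>An instance of Artin's theorem: the associator is trilinear and alternating, so on the
  spanning set only the triple \<open>x\<close>, \<open>y\<close>, \<open>x \<odot> y\<close>
  matters, and there the alternative laws give zero.\<close>

lemma associative_two_generated:
  "associative_on mul (span {e, x, y, x \<odot> y})"
proof -
  define as where "as p q r = (p \<odot> q) \<odot> r - p \<odot> (q \<odot> r)" for p q r
  let ?S = "{e, x, y, x \<odot> y}"
  have lin: "as (c \<cdot> p + p') q r = c \<cdot> as p q r + as p' q r"
    "as p (c \<cdot> q + q') r = c \<cdot> as p q r + as p q' r"
    "as p q (c \<cdot> r + r') = c \<cdot> as p q r + as p q r'" for c p p' q q' r r'
    by (simp_all add: as_def alg_simps algebra_simps)
  have zero: "as 0 q r = 0" "as p 0 r = 0" "as p q 0 = 0" for p q r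
    by (simp_all add: as_def alg_simps)
  have alt: "as p p q = 0" "as q p p = 0" "as p q p = 0" for p q
    by (simp_all add: as_def left_alternative right_alternative flexible)
  have swap: "as p q r = - as q p r" "as p q r = - as p r q" for p q r
    using alt(1)[of "p + q" r] alt(1)[of p r] alt(1)[of q r]
      alt(2)[of p "q + r"] alt(2)[of p r] alt(2)[of p q]
      lin(1)[of 1] lin(2)[of _ 1] lin(3)[of _ _ 1]
    by (simp_all add: eq_neg_iff_add_eq_0 add.commute)
  have one: "as e q r = 0" "as p e r = 0" "as p q e = 0" for p q r
    by (simp_all add: as_def alg_simps)
  have "as x (x \<odot> y) y = 0"
    by (simp add: as_def left_alternative right_alternative)
  then have xy: "as x (x \<odot> y) y = 0" "as x y (x \<odot> y) = 0" "as (x \<odot> y) x y = 0"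
    "as (x \<odot> y) y x = 0" "as y x (x \<odot> y) = 0" "as y (x \<odot> y) x = 0"
    using swap by (metis neg_equal_0_iff_equal)+
  have 1: "as p q r = 0" if "p \<in> ?S" "q \<in> ?S" "r \<in> ?S" for p q r
    using that by (elim insertE emptyE) (simp_all add: one alt xy)
  have 2: "as p q r = 0" if "r \<in> span ?S" "p \<in> ?S" "q \<in> ?S" for p q r
    using that(1) by (induction rule: span_induct_alt) (simp_all only: zero lin 1 that scale_zero_right add_0)
  have 3: "as p q r = 0" if "q \<in> span ?S" "p \<in> ?S" "r \<in> span ?S" for p q r
    using that(1) by (induction rule: span_induct_alt) (simp_all only: zero lin 2 that scale_zero_right add_0)
  have "as p q r = 0" if "p \<in> span ?S" "q \<in> span ?S" "r \<in> span ?S" for p q r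
    using that(1) by (induction rule: span_induct_alt) (simp_all only: zero lin 3 that scale_zero_right add_0)
  then show ?thesis
    by (simp add: associative_on_def as_def)
qed

text \<open>The trace-zero element \<open>c = 2 \<cdot> x - T x \<cdot> e\<close> has norm
  \<open>D = 4 * N x - (T x)\<^sup>2\<close>. By \<open>mul_swap\<close>, \<open>c \<odot> y\<close>
  lies in the span of \<open>e\<close> and \<open>x\<close>, and multiplying it by
  \<open>bar c\<close> recovers \<open>D \<cdot> y\<close>.\<close>

lemma commuting_separable:
  assumes comm: "x \<odot> y = y \<odot> x" and sep: "(T x)\<^sup>2 \<noteq> 4 * N x"
  shows "y \<in> span {e, x}"
proof -
  define c where "c = 2 \<cdot> x - T x \<cdot> e"
  define D where "D = 4 * N x - (T x)\<^sup>2"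
  have "N c = D"
    using norm_add[of "2 \<cdot> x" "- (T x \<cdot> e)"]
    by (simp add: c_def D_def norm_scale norm_minus N_e polar_simps power2_eq_square)
  moreover have "bar c = - c"
    by (simp add: bar_def c_def polar_simps T_e_2)
  moreover have "2 \<cdot> (x \<odot> y) = T x \<cdot> y + T y \<cdot> x - B x y \<cdot> e"
    using mul_swap[of x y] scale_left_distrib[of 1 1 "x \<odot> y"] by (simp add: comm)
  then have "c \<odot> y = T y \<cdot> x - B x y \<cdot> e"
    by (simp add: c_def alg_simps)
  ultimately have "D \<cdot> y = - c \<odot> (T y \<cdot> x - B x y \<cdot> e)"
    using bar_mul_cancel[of c y] by simp
  also have "\<dots> = (2 * T y * N x - T x * B x y) \<cdot> e + (2 * B x y - T x * T y) \<cdot> x"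
    by (simp add: c_def alg_simps square algebra_simps) (simp only: mult_2 scale_left_distrib)
  finally have "D \<cdot> y \<in> span {e, x}"
    by (simp add: span_add span_base span_scale)
  then have "inverse D \<cdot> (D \<cdot> y) \<in> span {e, x}"
    by (rule span_scale)
  then show ?thesis
    using sep by (simp add: D_def)
qed

text \<open>By \<open>square\<close>, these elements have square zero.\<close>

definition null_part :: "'a set \<Rightarrow> 'a set" where
  "null_part A = {x \<in> A. N x = 0 \<and> T x = 0}"

section \<open>Commutative subalgebras containing \<open>p0 w\<close> and
  \<open>n0 w\<close>\<close>

lemma commuting_coordinates:
  assumes \<phi>: "split_coordinates smul mul N \<phi>" and comm: "commutative_on mul A"
    and A: "\<phi> u \<in> A" "\<phi> v \<in> A"
  shows "std_mult u v = std_mult v u"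
proof -
  have "\<phi> (std_mult u v) = \<phi> (std_mult v u)"
    using comm A by (simp add: commutative_on_def split_coordinatesD(8)[OF \<phi>] del: std_mult.simps)
  then show ?thesis
    by (rule injD[OF split_coordinatesD(2)[OF \<phi>]])
qed

text \<open>Commuting with \<open>p0 w\<close> and \<open>n0 w\<close> compares the rows of
  \<open>a\<close> with those of its adjugate and kills the second row of \<open>k\<close>. The
  conditions \<open>- q = q\<close> and \<open>- r = r\<close> treat all characteristics at
  once.\<close>

lemma row_shape:
  assumes \<phi>: "split_coordinates smul mul N \<phi>" and comm: "commutative_on mul A"
    and A: "\<phi> (0, p0) \<in> A" "\<phi> (0, n0) \<in> A" "\<phi> (a, k) \<in> A"
  obtains p q r s t where "a = mat22 p q r p" "k = mat22 s t 0 0" "- q = q" "- r = r"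
proof -
  note D = split_coordinatesD[OF \<phi>]
  have "std_mult (a, k) (0, p0) = std_mult (0, p0) (a, k)"
    "std_mult (a, k) (0, n0) = std_mult (0, n0) (a, k)"
    using A by (blast intro: commuting_coordinates[OF \<phi> comm])+
  then show thesis
    by (cases a; cases k) (auto simp: mat22_special intro!: that)
qed

text \<open>Products of two first rows vanish in the first component, so a diagonal entry compares
  only the matrices. The off-diagonal parts are thus proportional.\<close>

lemma row_commute:
  assumes \<phi>: "split_coordinates smul mul N \<phi>" and comm: "commutative_on mul A"
    and A: "\<phi> (mat22 p q r p, mat22 s t 0 0) \<in> A" "\<phi> (mat22 p' q' r' p', mat22 s' t' 0 0) \<in> A"
  shows "q * r' = q' * r"
proof -
  note D = split_coordinatesD[OF \<phi>]
  have "std_mult (mat22 p q r p, mat22 s t 0 0) (mat22 p' q' r' p', mat22 s' t' 0 0) =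
    std_mult (mat22 p' q' r' p', mat22 s' t' 0 0) (mat22 p q r p, mat22 s t 0 0)"
    using A by (blast intro: commuting_coordinates[OF \<phi> comm])+
  then show ?thesis by simp
qed

lemma row_associative:
  assumes \<phi>: "split_coordinates smul mul N \<phi>" and comm: "commutative_on mul A"
    and A: "\<phi> (0, p0) \<in> A" "\<phi> (0, n0) \<in> A"
  shows "associative_on mul A"
  unfolding associative_on_def
proof (intro ballI)
  fix x y z assume xyz: "x \<in> A" "y \<in> A" "z \<in> A"
  note D = split_coordinatesD[OF \<phi>]
  obtain a k b l c m where eq: "x = \<phi> (a, k)" "y = \<phi> (b, l)" "z = \<phi> (c, m)"
    using D(3) by (metis surj_pair surjD)
  obtain p q r s t where 1: "a = mat22 p q r p" "k = mat22 s t 0 0" "- q = q" "- r = r"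
    using row_shape \<phi> comm A xyz(1) eq(1) by blast
  obtain p' q' r' s' t' where 2: "b = mat22 p' q' r' p'" "l = mat22 s' t' 0 0" "- q' = q'" "- r' = r'"
    using row_shape \<phi> comm A xyz(2) eq(2) by blast
  obtain p'' q'' r'' s'' t'' where 3: "c = mat22 p'' q'' r'' p''" "m = mat22 s'' t'' 0 0"
    "- q'' = q''" "- r'' = r''"
    using row_shape \<phi> comm A xyz(3) eq(3) by blast
  have 4: "q * r' = q' * r" "q * r'' = q'' * r" "q' * r'' = q'' * r'"
    using row_commute[OF \<phi> comm, of p q r s t p' q' r' s' t']
      row_commute[OF \<phi> comm, of p q r s t p'' q'' r'' s'' t'']
      row_commute[OF \<phi> comm, of p' q' r' s' t' p'' q'' r'' s'' t''] xyz
    by (simp_all add: eq 1(1,2) 2(1,2) 3(1,2))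
  have "std_mult (std_mult (a, k) (b, l)) (c, m) = std_mult (a, k) (std_mult (b, l) (c, m))"
    by (simp add: 1(1,2) 2(1,2) 3(1,2)) (simp add: 1(3,4) 2(3,4) 3(3,4) algebra_simps, use 4 in algebra)
  then show "(x \<odot> y) \<odot> z = x \<odot> (y \<odot> z)"
    unfolding eq D(8)[symmetric] by simp
qed


lemma subalgebraD:
  assumes "is_subalgebra smul mul A"
  shows "subspace A" "0 \<in> A" "x \<in> A \<Longrightarrow> y \<in> A \<Longrightarrow> x + y \<in> A" "x \<in> A \<Longrightarrow> y \<in> A \<Longrightarrow> x - y \<in> A"
    "x \<in> A \<Longrightarrow> c \<cdot> x \<in> A" "x \<in> A \<Longrightarrow> y \<in> A \<Longrightarrow> x \<odot> y \<in> A"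
  using assms by (auto simp: is_subalgebra_def subspace_0 subspace_add subspace_diff subspace_scale)

text \<open>The quadratic equation of \<open>x\<close> can be solved for \<open>e\<close>.\<close>

lemma subalgebra_e:
  assumes "is_subalgebra smul mul A" "x \<in> A" "N x \<noteq> 0"
  shows "e \<in> A"
proof -
  have "inverse (N x) \<cdot> (T x \<cdot> x - x \<odot> x) \<in> A"
    using assms(2) by (intro subalgebraD[OF assms(1)])
  then show ?thesis
    using assms(3) by (simp add: square)
qed

text \<open>The right ideal spanned by \<open>p0\<close> and \<open>n0\<close>, the common second
  factor of all four models.\<close>

definition first_rows :: "'f mat2 set" where
  "first_rows = {mat22 s t 0 0 | s t. True}"

lemma model_products:
  "model_null = {0} \<times> first_rows"
  "model_unital_null = range mat \<times> first_rows"
  "model_heisenberg = range (\<lambda>r. mat_scale r n0) \<times> first_rows"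
  "model_B b = {mat r + mat_scale q b | r q. True} \<times> first_rows"
  by (auto simp: model_null_def model_unital_null_def model_heisenberg_def model_B_def
      first_rows_def mat22_special)

text \<open>Everything is determined by the matrix part \<open>R\<close>: it consists of scalars, or
  the characteristic is two and \<open>R\<close> is a plane containing the scalars or the line
  through \<open>n0\<close>. Assumption \<open>prod\<close> records the two ways in which the
  coordinates arise.\<close>

lemma row_classification:
  assumes \<phi>: "split_coordinates smul mul N \<phi>"
    and sub: "is_subalgebra smul mul A" and comm: "commutative_on mul A"
    and U: "\<phi> (0, p0) \<in> A" "\<phi> (0, n0) \<in> A"
    and null: "e \<notin> A \<Longrightarrow> null_part A = A"
    and prod: "\<phi> (n0, 0) \<in> A \<or> (\<forall>x\<in>null_part A. \<forall>y\<in>null_part A. x \<odot> y = 0)"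
  shows "A = \<phi> ` model_null \<or> A = \<phi> ` model_unital_null \<or>
    (2::'f) = 0 \<and> (A = \<phi> ` model_heisenberg \<or>
      (\<exists>b. polar std_norm (b, 0) (mat 1, 0) = 0 \<and> b \<notin> range mat \<and> A = \<phi> ` model_B b))"
proof -
  note D = split_coordinatesD[OF \<phi>] and S = subalgebraD[OF sub]
  define R where "R = {a. \<phi> (a, 0) \<in> A}"
  have row: "\<phi> (0, mat22 s t 0 0) \<in> A" for s t
  proof -
    have "\<phi> (0, mat22 s t 0 0) = s \<cdot> \<phi> (0, p0) + t \<cdot> \<phi> (0, n0)"
      by (simp add: mat22_special flip: D(4,5))
    then show ?thesis using U S by simp
  qed
  have A_R: "\<phi> (a, mat22 s t 0 0) \<in> A \<longleftrightarrow> a \<in> R" for a s t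
    using S(3)[of "\<phi> (a, 0)", OF _ row[of s t]] S(4)[of "\<phi> (a, mat22 s t 0 0)", OF _ row[of s t]]
    by (auto simp: R_def simp flip: D(4,7))
  have A_eq: "A = \<phi> ` (R \<times> first_rows)"
  proof (intro equalityI subsetI)
    fix x assume x: "x \<in> A"
    obtain a k where ak: "x = \<phi> (a, k)"
      using D(3) by (metis surj_pair surjD)
    obtain s t where "k = mat22 s t 0 0"
      using row_shape[OF \<phi> comm U] x ak by metis
    then show "x \<in> \<phi> ` (R \<times> first_rows)"
      using x A_R by (auto simp: ak first_rows_def)
  qed (auto simp: first_rows_def A_R)
  have R_add: "a + b \<in> R" if "a \<in> R" "b \<in> R" for a b
    using S(3)[of "\<phi> (a, 0)" "\<phi> (b, 0)"] that by (simp add: R_def flip: D(4))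
  have R_diff: "a - b \<in> R" if "a \<in> R" "b \<in> R" for a b
    using S(4)[of "\<phi> (a, 0)" "\<phi> (b, 0)"] that by (simp add: R_def flip: D(7))
  have zero_std: "mat_scale c (0 :: 'f mat2) = 0" for c
    by (simp add: mat22_special)
  have R_scale: "mat_scale c a \<in> R" if "a \<in> R" for a c
    using S(5)[of "\<phi> (a, 0)" c] that by (simp add: R_def zero_std flip: D(5))
  have R_one: "mat 1 \<in> R \<longleftrightarrow> e \<in> A"
    by (simp add: R_def D)
  have R_mat: "p = 0" if "mat p \<in> R" "e \<notin> A" for p
  proof (rule ccontr)
    assume "p \<noteq> 0"
    then have "mat 1 = mat_scale (inverse p) (mat p)"
      by (simp add: mat22_special)
    then show False
      using that R_scale R_one by metis
  qed
  have R_shape: "\<exists>p q r. a = mat22 p q r p \<and> - q = q \<and> - r = r" if "a \<in> R" for a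
    using row_shape[OF \<phi> comm U, of a 0] that unfolding R_def by blast
  have R_comm: "q * r' = q' * r" if "mat22 p q r p \<in> R" "mat22 p' q' r' p' \<in> R" for p q r p' q' r'
    using row_commute[OF \<phi> comm, of p q r 0 0 p' q' r' 0 0] that
    by (simp add: R_def mat22_special)
  show ?thesis
  proof (cases "R \<subseteq> range mat")
    case True
    show ?thesis
    proof (cases "e \<in> A")
      case e: True
      have "mat r = mat_scale r (mat 1)" for r :: 'f
        by (simp add: mat22_special)
      then have "R = range mat"
        using True R_one R_scale e by (metis image_subset_iff subset_antisym)
      then show ?thesis
        by (simp add: A_eq model_products)
    next
      case False
      have "0 \<in> R" using D(6) S(2) by (simp add: R_def zero_prod_def)
      moreover have "mat 0 = (0 :: 'f mat2)"
        by (simp add: mat22_special)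
      ultimately have "R = {0}"
        using True R_mat False by blast
      then show ?thesis
        by (simp add: A_eq model_products)
    qed
  next
    case False
    then obtain b where b: "b \<in> R" "b \<notin> range mat" by blast
    then obtain p q r where b_eq: "b = mat22 p q r p" and qr: "- q = q" "- r = r"
      using R_shape by blast
    have qr0: "q \<noteq> 0 \<or> r \<noteq> 0"
      using b(2) by (auto simp: b_eq mat22_special)
    have "2 * q = 0" "2 * r = 0"
      using qr by (metis add.right_inverse mult_2)+
    then have two: "(2::'f) = 0"
      using qr0 by auto
    show ?thesis
    proof (cases "e \<in> A")
      case True
      have "R = {mat c + mat_scale d b | c d. True}"
      proof (intro equalityI subsetI)
        fix a assume a: "a \<in> R"
        obtain p' q' r' where a_eq: "a = mat22 p' q' r' p'"
          using R_shape a by blast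
        have *: "q * r' = q' * r"
          using R_comm[of p q r p' q' r'] a b by (simp add: a_eq b_eq)
        \<comment> \<open>The common ratio of the off-diagonal entries of \<open>a\<close> and
          \<open>b\<close>, read off at a non-zero entry of \<open>b\<close>.\<close>
        define d where "d = (if q \<noteq> 0 then q' / q else r' / r)"
        have "d * q = q'" "d * r = r'"
          using * qr0 by (auto simp: d_def field_simps)
        then have "a = mat (p' - d * p) + mat_scale d b"
          by (simp add: a_eq b_eq mat22_special)
        then show "a \<in> {mat c + mat_scale d b | c d. True}" by blast
      next
        fix a assume "a \<in> {mat c + mat_scale d b | c d. True}"
        then obtain c d where "a = mat_scale c (mat 1) + mat_scale d b"
          by (auto simp: mat22_special)
        then show "a \<in> R"
          using R_add R_scale R_one True b by simp
      qed
      moreover have "polar std_norm (b, 0) (mat 1, 0) = 0"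
        using two by (simp add: b_eq mat22_special polar_std_norm flip: mult_2)
      ultimately show ?thesis
        using two b by (auto simp: A_eq model_products)
    next
      case no_e: False
      \<comment> \<open>Otherwise all products in \<open>A\<close> vanish by \<open>prod\<close>,
        but the products of \<open>b\<close> with \<open>p0 w\<close> and \<open>n0 w\<close> have
        \<open>q\<close> and \<open>r\<close> among their entries.\<close>
      have "n0 \<in> R"
      proof (rule ccontr)
        assume "n0 \<notin> R"
        then have "x \<odot> y = 0" if "x \<in> A" "y \<in> A" for x y
          using prod null no_e that by (auto simp: R_def)
        then have "\<phi> (std_mult (b, 0) (0, p0)) = \<phi> 0" "\<phi> (std_mult (b, 0) (0, n0)) = \<phi> 0"
          using b U by (simp_all add: D(6,8) R_def del: std_mult.simps)
        then have "std_mult (b, 0) (0, p0) = 0" "std_mult (b, 0) (0, n0) = 0"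
          using D(2) by (metis injD)+
        then show False
          using qr0 by (auto simp: b_eq mat22_special zero_prod_def)
      qed
      have "R = range (\<lambda>r. mat_scale r n0)"
      proof (intro equalityI subsetI)
        fix a assume a: "a \<in> R"
        obtain p' q' r' where a_eq: "a = mat22 p' q' r' p'"
          using R_shape a by blast
        have "r' = 0"
          using R_comm[of 0 1 0 p' q' r'] a \<open>n0 \<in> R\<close> by (simp add: a_eq mat22_special)
        then have "mat p' = a - mat_scale q' n0"
          by (simp add: a_eq mat22_special)
        then have "p' = 0"
          using R_mat no_e R_diff R_scale a \<open>n0 \<in> R\<close> by metis
        then show "a \<in> range (\<lambda>r. mat_scale r n0)"
          using \<open>r' = 0\<close> by (auto simp: a_eq mat22_special)
      qed (use R_scale \<open>n0 \<in> R\<close> in auto)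
      then show ?thesis
        using two by (simp add: A_eq model_products)
    qed
  qed
qed

section \<open>The three kinds of commutative subalgebra\<close>

lemma polar_zero_char_2:
  assumes comm: "x \<odot> y = y \<odot> x" and two: "(2::'f) = 0" and T: "T x = 0" "T y = 0"
  shows "B x y = 0"
proof -
  have "x \<odot> y + x \<odot> y = 2 \<cdot> (x \<odot> y)"
    using scale_left_distrib[of 1 1 "x \<odot> y"] by simp
  then show ?thesis
    using mul_swap[of x y] comm two T e_nonzero by simp
qed

text \<open>The clauses of case \<open>rows\<close> are the hypotheses of
  \<open>row_classification\<close>. Case \<open>aniso\<close> arises for a unital \<open>A\<close>
  in characteristic two whose null part is zero.\<close>

lemma commutative_cases:
  assumes sub: "is_subalgebra smul mul A" and comm: "commutative_on mul A"
  obtains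
    (two_dim) x where "A \<subseteq> span {e, x}"
  | (rows) \<phi> where "split_coordinates smul mul N \<phi>" "\<phi> (0, p0) \<in> A" "\<phi> (0, n0) \<in> A"
      "e \<notin> A \<Longrightarrow> null_part A = A"
      "\<phi> (n0, 0) \<in> A \<or> (\<forall>x\<in>null_part A. \<forall>y\<in>null_part A. x \<odot> y = 0)"
  | (aniso) "(2::'f) = 0" "e \<in> A" "\<And>x. x \<in> A \<Longrightarrow> N x = 0 \<Longrightarrow> x = 0" "\<And>x. x \<in> A \<Longrightarrow> T x = 0"
proof (cases "\<exists>x\<in>A. (T x)\<^sup>2 \<noteq> 4 * N x")
  case True
  then obtain x where x: "x \<in> A" "(T x)\<^sup>2 \<noteq> 4 * N x" by blast
  then have "A \<subseteq> span {e, x}"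
    using comm commuting_separable by (auto simp: commutative_on_def)
  then show thesis by (rule two_dim)
next
  case False
  note S = subalgebraD[OF sub]
  have disc: "(T x)\<^sup>2 = 4 * N x" if "x \<in> A" for x
    using False that by blast
  have comm: "x \<odot> y = y \<odot> x" if "x \<in> A" "y \<in> A" for x y
    using comm that by (auto simp: commutative_on_def)
  \<comment> \<open>Without \<open>e\<close> all norms vanish by \<open>subalgebra_e\<close>, and
    \<open>disc\<close> then makes the traces vanish too.\<close>
  have no_e: "null_part A = A" if "e \<notin> A"
    using that disc subalgebra_e[OF sub] by (force simp: null_part_def)
  have four: "(4::'f) = 0 \<longleftrightarrow> (2::'f) = 0"
    using mult_eq_0_iff[of "2::'f" 2] by simp
  have T0: "T x = 0" if "x \<in> A" "(2::'f) = 0" for x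
    using disc[OF that(1)] that(2) four by simp
  have polar0: "B x y = 0" if "x \<in> null_part A" "y \<in> null_part A" for x y
  proof (cases "(2::'f) = 0")
    case True
    then show ?thesis
      using that comm polar_zero_char_2 by (auto simp: null_part_def)
  next
    case False
    have "(T (x + y))\<^sup>2 = 4 * N (x + y)"
      using that S by (intro disc) (auto simp: null_part_def)
    then have "4 * B x y = 0"
      using that by (simp add: null_part_def polar_simps norm_add)
    then show ?thesis using False four by simp
  qed
  show thesis
  proof (cases "\<exists>x\<in>null_part A. \<exists>y\<in>null_part A. x \<odot> y \<noteq> 0")
    case True
    then obtain x y where xy: "x \<in> null_part A" "y \<in> null_part A" "x \<odot> y \<noteq> 0" by blast
    then have A: "x \<in> A" "y \<in> A" "N x = 0" "T x = 0" "N y = 0" "T y = 0"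
      by (simp_all add: null_part_def)
    obtain \<phi> where \<phi>: "split_coordinates smul mul N \<phi>" "\<phi> (n0, 0) = x" "\<phi> (0, p0) = y"
      "\<phi> (0, n0) = x \<odot> y"
      using heisenberg_coordinates[OF A(3-6) polar0[OF xy(1,2)] xy(3)] by blast
    show thesis
      by (rule rows[OF \<phi>(1)]) (use \<phi> A S(6) no_e in simp_all)
  next
    case prod: False
    show thesis
    proof (cases "\<exists>u\<in>null_part A. \<exists>v\<in>null_part A. u \<noteq> 0 \<and> (\<forall>c. v \<noteq> c \<cdot> u)")
      case True
      then obtain u v where uv: "u \<in> null_part A" "v \<in> null_part A" "u \<noteq> 0" "\<And>c. v \<noteq> c \<cdot> u"
        by blast
      then have A: "u \<in> A" "v \<in> A" "N u = 0" "T u = 0" "N v = 0" "T v = 0" "u \<odot> v = 0"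
        using prod by (auto simp: null_part_def)
      obtain \<phi> where \<phi>: "split_coordinates smul mul N \<phi>" "\<phi> (0, p0) = u" "\<phi> (0, n0) = v"
        using null_algebra_coordinates[OF uv(3) A(3-6) uv(4) A(7)] by blast
      show thesis
        by (rule rows[OF \<phi>(1)]) (use \<phi> A no_e prod in auto)
    next
      case small: False
      \<comment> \<open>The null part is at most a line; \<open>u\<close> spans it and is zero
        exactly when the null part is trivial.\<close>
      obtain u where u: "u \<in> null_part A" "\<And>z. z \<in> null_part A \<Longrightarrow> \<exists>c. z = c \<cdot> u"
        "u = 0 \<longleftrightarrow> null_part A = {0}"
      proof (cases "null_part A = {0}")
        case True
        then show thesis by (intro that[of 0]) auto
      next
        case False
        moreover have "0 \<in> null_part A"
          using S(2) by (simp add: null_part_def norm_zero polar_zero_left)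
        ultimately obtain u where "u \<in> null_part A" "u \<noteq> 0" by blast
        then show thesis
          using small by (intro that[of u]) auto
      qed
      have shift: "x \<in> span {e, u}" if null: "x - r \<cdot> e \<in> null_part A" for x r
      proof -
        obtain c where "x - r \<cdot> e = c \<cdot> u" using u(2)[OF null] by blast
        then have "x = r \<cdot> e + c \<cdot> u" by (simp add: algebra_simps)
        then show ?thesis by (simp add: span_add span_scale span_base)
      qed
      show thesis
      proof (cases "e \<in> A")
        case False
        then have "A \<subseteq> span {e, u}"
          using no_e[OF False] shift[of _ 0] by auto
        then show thesis by (rule two_dim)
      next
        case e: True
        show thesis
        proof (cases "(2::'f) = 0")
          case two: False
          \<comment> \<open>Away from characteristic two the trace can be removed by a scalar shift,
            and \<open>disc\<close> forces the norm to vanish with it.\<close>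
          have "x - (T x / 2) \<cdot> e \<in> null_part A" if "x \<in> A" for x
          proof -
            have A: "x - (T x / 2) \<cdot> e \<in> A" using e that by (intro S)
            have T: "T (x - (T x / 2) \<cdot> e) = 0"
              using two by (simp add: polar_simps T_e_2)
            then have "4 * N (x - (T x / 2) \<cdot> e) = 0"
              using disc[OF A] by simp
            then show ?thesis using two four A T by (simp add: null_part_def)
          qed
          then have "A \<subseteq> span {e, u}"
            using shift by blast
          then show thesis by (rule two_dim)
        next
          case two: True
          show thesis
          proof (cases "u = 0")
            case True
            then have "null_part A = {0}" using u(3) by simp
            then have "x = 0" if "x \<in> A" "N x = 0" for x
              using T0[OF that(1) two] that by (auto simp: null_part_def)
            then show thesis
              using aniso two e T0 by blast
          next
            case False
            \<comment> \<open>The product \<open>x \<odot> u\<close> is null again, hence a multiple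
              \<open>c \<cdot> u\<close>. So \<open>x - c \<cdot> e\<close> annihilates
              \<open>u\<close> and must have norm zero.\<close>
            have "\<exists>c. x - c \<cdot> e \<in> null_part A" if x: "x \<in> A" for x
            proof -
              have uA: "u \<in> A" "N u = 0" using u(1) by (auto simp: null_part_def)
              then have "x \<odot> u \<in> null_part A"
                using x S(6) T0 two by (simp add: null_part_def norm_mult)
              then obtain c where "x \<odot> u = c \<cdot> u" using u(2) by blast
              then have "(x - c \<cdot> e) \<odot> u = 0" by (simp add: alg_simps)
              then have "N (x - c \<cdot> e) \<cdot> u = 0"
                using bar_mul_cancel[of "x - c \<cdot> e" u] by (simp add: alg_simps)
              then have "x - c \<cdot> e \<in> null_part A"
                using \<open>u \<noteq> 0\<close> S(4,5) x e T0 two by (simp add: null_part_def)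
              then show ?thesis by blast
            qed
            then have "A \<subseteq> span {e, u}"
              using shift by blast
            then show thesis by (rule two_dim)
          qed
        qed
      qed
    qed
  qed
qed

section \<open>Dimension counts\<close>

lemma in_span_2_iff: "x \<in> span {a, b} \<longleftrightarrow> (\<exists>r s. x = r \<cdot> a + s \<cdot> b)"
  using in_span_2 by (auto simp: span_add span_scale span_base)

lemma in_span_3_iff: "x \<in> span {a, b, c} \<longleftrightarrow> (\<exists>r s t. x = r \<cdot> a + s \<cdot> b + t \<cdot> c)"
  using in_span_3 by (auto simp: span_add span_scale span_base)

lemma in_span_4_iff: "x \<in> span {a, b, c, d} \<longleftrightarrow> (\<exists>r s t q. x = r \<cdot> a + s \<cdot> b + t \<cdot> c + q \<cdot> d)"
proof
  assume "x \<in> span {a, b, c, d}"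
  then obtain r where "x - r \<cdot> a \<in> span {b, c, d}"
    using span_breakdown_eq by blast
  then obtain s t q where "x - r \<cdot> a = s \<cdot> b + t \<cdot> c + q \<cdot> d"
    using in_span_3 by blast
  then have "x = r \<cdot> a + s \<cdot> b + t \<cdot> c + q \<cdot> d"
    by (simp add: algebra_simps)
  then show "\<exists>r s t q. x = r \<cdot> a + s \<cdot> b + t \<cdot> c + q \<cdot> d" by blast
qed (auto simp: span_add span_scale span_base)

lemma dim_insert_notin:
  assumes "x \<notin> span S"
  shows "dim (insert x S) = Suc (dim S)"
proof -
  obtain C where "finite_dimensional_vector_space smul C"
    using finite_basis by blast
  then interpret fd: finite_dimensional_vector_space smul C by simp
  show ?thesis using fd.dim_insert[of x S] assms by simp
qed

lemma dim_subspace_eq: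
  assumes "subspace A" "subspace A'" "A \<subseteq> A'" "dim A = dim A'"
  shows "A = A'"
proof -
  obtain C where "finite_dimensional_vector_space smul C"
    using finite_basis by blast
  then interpret fd: finite_dimensional_vector_space smul C by simp
  show ?thesis using fd.subspace_dim_equal assms by simp
qed

lemma dim_zero: "dim {} = 0"
  using dim_eq_card_independent[of "{}"] independent_empty by simp

lemma dim_one: "x \<noteq> 0 \<Longrightarrow> dim {x} = 1"
  using dim_insert_notin[of x "{}"] by (simp add: dim_zero span_empty)

lemma dim_one_obtain:
  assumes "subspace A" "dim A = 1"
  obtains x where "A = span {x}"
  using exists_dim_basis[OF assms(1)] assms(2) by (metis card_1_singletonE)

lemma one_gen_span: "one_gen smul e a = span {e, a}"
  by (simp add: set_eq_iff one_gen_def in_span_2_iff)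

lemma dim_pair_le:
  assumes "A \<subseteq> span {a, b}"
  shows "dim A \<le> 2"
proof -
  have "dim A \<le> card {a, b}"
    using dim_le_card[OF assms] by simp
  also have "\<dots> \<le> 2" by (simp add: card_insert_if)
  finally show ?thesis .
qed

lemma two_dim_cases:
  assumes "subspace A" "A \<noteq> {0}" "A \<subseteq> span {e, x}"
  shows "case_a smul A \<or> case_b smul e A"
proof -
  obtain S where S: "finite S" "span S = A" "card S = dim A"
    using exists_dim_basis assms(1) by metis
  have "dim A \<noteq> 0"
    using S assms(2) by (metis card_0_eq span_empty)
  then consider "dim A = 1" | "dim A = 2"
    using dim_pair_le[OF assms(3)] by linarith
  then show ?thesis
  proof cases
    case 2
    have "dim (span {e, x}) \<le> 2"
      using dim_pair_le by blast
    moreover have "dim A \<le> dim (span {e, x})"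
    proof -
      obtain C where "finite_dimensional_vector_space smul C"
        using finite_basis by blast
      then interpret fd: finite_dimensional_vector_space smul C by simp
      show ?thesis using fd.dim_subset assms(3) by blast
    qed
    ultimately have "A = span {e, x}"
      using 2 assms by (intro dim_subspace_eq) auto
    then show ?thesis
      using 2 by (auto simp: case_b_def one_gen_span)
  qed (simp add: case_a_def)
qed

text \<open>Supplies the dimension clauses of the orbit cases, by exhibiting each model as the span
  of independent vectors.\<close>

lemma model_dims:
  assumes \<phi>: "split_coordinates smul mul N \<phi>"
  shows "dim (\<phi> ` model_null) = 2" "dim (\<phi> ` model_unital_null) = 3"
    "dim (\<phi> ` model_heisenberg) = 3" "b \<notin> range mat \<Longrightarrow> dim (\<phi> ` model_B b) = 4"
proof -
  note D = split_coordinatesD[OF \<phi>]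
  define u v where uv: "u = \<phi> (0, p0)" "v = \<phi> (0, n0)"
  have lin: "r \<cdot> \<phi> (a, 0) + s \<cdot> u + t \<cdot> v = \<phi> (mat_scale r a, mat_scale s p0 + mat_scale t n0)" for r s t a
    by (cases a) (simp add: uv mat22_special flip: D(4,5))
  have lin2: "s \<cdot> u + t \<cdot> v = \<phi> (0, mat_scale s p0 + mat_scale t n0)" for s t
    by (simp add: uv mat22_special flip: D(4,5))
  have lin4: "q \<cdot> \<phi> (b, 0) + r \<cdot> e + s \<cdot> u + t \<cdot> v =
      \<phi> (mat r + mat_scale q b, mat_scale s p0 + mat_scale t n0)" for q r s t b
    by (cases b) (simp add: uv D(11)[symmetric] mat22_special add.commute flip: D(4,5))
  have "u \<noteq> 0"
    using injD[OF D(2), of "(0, p0)" 0] D(6) by (auto simp: uv zero_prod_def mat22_special)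
  then have 1: "dim {u} = 1" by (rule dim_one)
  have "u \<notin> span {v}"
  proof
    assume "u \<in> span {v}"
    then obtain c where "u = c \<cdot> v" using in_span_1 by blast
    then have "\<phi> (0, p0) = \<phi> (std_scale c (0, n0))"
      by (simp only: uv D(5))
    then show False
      using D(2) by (auto simp: inj_eq mat22_special)
  qed
  moreover have "v \<noteq> 0"
    using injD[OF D(2), of "(0, n0)" 0] D(6) by (auto simp: uv zero_prod_def mat22_special)
  ultimately have 2: "dim {u, v} = 2"
    using dim_insert_notin[of u "{v}"] dim_one[of v] by simp
  have 3: "dim {\<phi> (a, 0), u, v} = 3" if "a \<noteq> 0" for a
  proof -
    have "\<phi> (a, 0) \<notin> span {u, v}"
      using that D(2) by (auto simp: in_span_2_iff lin2 inj_eq)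
    then show ?thesis using 2 dim_insert_notin[of "\<phi> (a, 0)" "{u, v}"] by simp
  qed
  have e: "e = \<phi> (mat 1, 0)" using D by simp
  have 4: "dim {\<phi> (b, 0), e, u, v} = 4" if "b \<notin> range mat" for b
  proof -
    have "mat_scale r (mat 1) = mat r" for r :: 'f
      by (simp add: mat22_special)
    then have "\<phi> (b, 0) \<notin> span {e, u, v}"
      using that D(2) unfolding e in_span_3_iff lin by (auto simp: inj_eq)
    moreover have "mat 1 \<noteq> (0 :: 'f mat2)"
      by (simp add: mat22_special)
    ultimately show ?thesis using 3[of "mat 1"] dim_insert_notin[of "\<phi> (b, 0)" "{e, u, v}"]
      by (simp flip: e)
  qed
  have "\<phi> ` model_null = {s \<cdot> u + t \<cdot> v | s t. True}"
    unfolding lin2 model_null_def by blast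
  then have "\<phi> ` model_null = span {u, v}"
    by (simp add: set_eq_iff in_span_2_iff)
  then show "dim (\<phi> ` model_null) = 2" using 2 by simp
  have one: "mat r = mat_scale r (mat 1)" for r :: 'f
    by (simp add: mat22_special)
  have "\<phi> ` model_unital_null = {r \<cdot> \<phi> (mat 1, 0) + s \<cdot> u + t \<cdot> v | r s t. True}"
    unfolding lin model_unital_null_def one[symmetric] by blast
  then have "\<phi> ` model_unital_null = span {\<phi> (mat 1, 0), u, v}"
    by (simp add: set_eq_iff in_span_3_iff)
  moreover have "mat 1 \<noteq> (0 :: 'f mat2)" "n0 \<noteq> (0 :: 'f mat2)"
    by (simp_all add: mat22_special)
  ultimately show "dim (\<phi> ` model_unital_null) = 3" using 3 by simp
  have "\<phi> ` model_heisenberg = {r \<cdot> \<phi> (n0, 0) + s \<cdot> u + t \<cdot> v | r s t. True}"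
    unfolding lin model_heisenberg_def by blast
  then have "\<phi> ` model_heisenberg = span {\<phi> (n0, 0), u, v}"
    by (simp add: set_eq_iff in_span_3_iff)
  then show "dim (\<phi> ` model_heisenberg) = 3" using 3 \<open>n0 \<noteq> 0\<close> by simp
  have "\<phi> ` model_B b = {q \<cdot> \<phi> (b, 0) + r \<cdot> e + s \<cdot> u + t \<cdot> v | q r s t. True}" for b
    unfolding lin4 model_B_def by blast
  then have "\<phi> ` model_B b = span {\<phi> (b, 0), e, u, v}" for b
    by (simp add: set_eq_iff in_span_4_iff)
  then show "dim (\<phi> ` model_B b) = 4" if "b \<notin> range mat" using 4 that by simp
qed

lemma split_coordinates_is_split:
  assumes "split_coordinates smul mul N \<phi>"
  shows "is_split N"
proof -
  note D = split_coordinatesD[OF assms]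
  have "\<phi> (n0, 0) \<noteq> 0"
    using injD[OF D(2), of "(n0, 0)" 0] D(6) by (auto simp: zero_prod_def mat22_special)
  moreover have "N (\<phi> (n0, 0)) = 0"
    by (simp add: D std_norm_def mat22_special)
  ultimately show ?thesis by (auto simp: is_split_def)
qed

text \<open>By \<open>large\<close>, there are \<open>x\<close> and \<open>y\<close> for which
  \<open>e\<close>, \<open>x\<close>, \<open>y\<close>, \<open>x \<odot> y\<close> turn out
  independent. The polar form vanishes on \<open>A\<close>, so \<open>totally_isotropic_card\<close>
  leaves no room for a fifth vector; inverses come from \<open>square\<close>.\<close>

lemma anisotropic_field:
  assumes sub: "is_subalgebra smul mul A" and comm: "commutative_on mul A"
    and two: "(2::'f) = 0" and e: "e \<in> A"
    and aniso: "\<And>x. x \<in> A \<Longrightarrow> N x = 0 \<Longrightarrow> x = 0" and T: "\<And>x. x \<in> A \<Longrightarrow> T x = 0"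
    and large: "\<And>x. \<not> A \<subseteq> span {e, x}"
  shows "associative_on mul A" and "case_g smul mul e A"
proof -
  note S = subalgebraD[OF sub]
  have polar0: "B x y = 0" if "x \<in> A" "y \<in> A" for x y
    using that comm two T polar_zero_char_2 by (auto simp: commutative_on_def)
  have sq: "x \<odot> x = - N x \<cdot> e" if "x \<in> A" for x
    using T that by (simp add: square)
  obtain x where x: "x \<in> A" "x \<notin> span {e}"
    using large[of e] by auto
  obtain y where y: "y \<in> A" "y \<notin> span {e, x}"
    using large[of x] by auto
  have "x \<odot> y \<notin> span {e, x, y}"
  proof
    assume "x \<odot> y \<in> span {e, x, y}"
    then obtain r s t where xy: "x \<odot> y = r \<cdot> e + s \<cdot> x + t \<cdot> y"
      using in_span_3 by blast
    \<comment> \<open>These factor the relation: \<open>x1 \<odot> y1\<close> is the scalar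
      \<open>r + s * t\<close>. Multiplying by \<open>x1\<close>, whose norm is non-zero, puts
      \<open>y\<close> into the span of \<open>e\<close> and \<open>x\<close>.\<close>
    define x1 y1 where "x1 = x - t \<cdot> e" and "y1 = y - s \<cdot> e"
    have x1: "x1 \<in> A" using x e S by (simp add: x1_def)
    have "x1 \<noteq> 0"
      using x(2) by (auto simp: x1_def span_singleton)
    then have "N x1 \<noteq> 0" using aniso x1 by blast
    have "x1 \<odot> y1 = (r + s * t) \<cdot> e"
      by (simp add: x1_def y1_def alg_simps xy algebra_simps)
    then have "- N x1 \<cdot> y1 = (r + s * t) \<cdot> x1"
      using left_alternative[of x1 y1] x1 by (simp add: sq alg_simps)
    then have "y1 = (- inverse (N x1) * (r + s * t)) \<cdot> x1"
      using \<open>N x1 \<noteq> 0\<close>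
      by (metis (no_types, lifting) neg_equal_0_iff_equal inverse_minus_eq left_inverse scale_one scale_scale)
    then have "y = s \<cdot> e + (- inverse (N x1) * (r + s * t)) \<cdot> (x - t \<cdot> e)"
      by (simp add: y1_def x1_def algebra_simps)
    also have "\<dots> \<in> span {e, x}"
      by (intro span_add span_diff span_scale span_base) auto
    finally show False using y by blast
  qed
  then have "x \<odot> y \<notin> span {y, x, e}" "y \<notin> span {x, e}" "x \<notin> span {e}"
    using x y by (simp_all add: insert_commute)
  moreover from this have "x \<odot> y \<notin> {y, x, e}" "y \<notin> {x, e}" "x \<notin> {e}"
    by (meson span_superset subsetD)+
  ultimately have ind: "independent {x \<odot> y, y, x, e}" and card: "card {x \<odot> y, y, x, e} = 4"
    by (simp_all add: independent_insertI e_nonzero)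
  have "{x \<odot> y, y, x, e} \<subseteq> A" using x y e S(6) by simp
  have "z \<in> span {x \<odot> y, y, x, e}" if "z \<in> A" for z
  proof (rule ccontr)
    assume z: "z \<notin> span {x \<odot> y, y, x, e}"
    have "insert z {x \<odot> y, y, x, e} \<subseteq> A"
      using \<open>_ \<subseteq> A\<close> that by simp
    then have "card (insert z {x \<odot> y, y, x, e}) \<le> 4"
      using totally_isotropic_card[OF independent_insertI[OF z ind]] polar0 by (meson subsetD)
    moreover have "z \<notin> {x \<odot> y, y, x, e}" using z span_base[of z] by metis
    ultimately show False
      using card card_insert_disjoint[of "{x \<odot> y, y, x, e}" z] by simp
  qed
  then have "A \<subseteq> span {x \<odot> y, y, x, e}" by blast
  then have "dim A = 4"
    using basis_card_eq_dim[OF \<open>_ \<subseteq> A\<close> _ ind] card by simp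
  have "A \<subseteq> span {e, x, y, x \<odot> y}"
    using \<open>A \<subseteq> _\<close> by (simp add: insert_commute)
  then show assoc: "associative_on mul A"
    using associative_two_generated[of x y] unfolding associative_on_def subset_iff by blast
  have "\<exists>y\<in>A. z \<odot> y = e" if "z \<in> A" "z \<noteq> 0" for z
  proof
    have "N z \<noteq> 0" using aniso that by blast
    then show "z \<odot> ((- inverse (N z)) \<cdot> z) = e"
      using that by (simp add: mul_scale_right mul_minus_right sq)
    show "(- inverse (N z)) \<cdot> z \<in> A"
      using that(1) by (rule S(5))
  qed
  moreover have "x \<odot> x \<in> range (\<lambda>c. c \<cdot> e)" if "x \<in> A" for x
    using sq[OF that] rangeI[of "\<lambda>c. c \<cdot> e" "- N x"] by simp
  ultimately show "case_g smul mul e A"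
    using \<open>dim A = 4\<close> sub comm assoc e e_nonzero
    by (simp add: case_g_def field_extension_in_def)
qed

lemma commutative_imp_associative:
  assumes sub: "is_subalgebra smul mul A" and comm: "commutative_on mul A"
  shows "associative_on mul A"
proof -
  have *: ?thesis if "A \<subseteq> span {e, x}" for x
  proof -
    have "A \<subseteq> span {e, x, x, x \<odot> x}"
      using that span_mono[of "{e, x}" "{e, x, x, x \<odot> x}"] by auto
    then show ?thesis
      using associative_two_generated[of x x] unfolding associative_on_def subset_iff by blast
  qed
  show ?thesis
    using sub comm
  proof (cases rule: commutative_cases)
    case rows
    then show ?thesis using row_associative comm by blast
  next
    case aniso
    then show ?thesis using * anisotropic_field(1)[OF sub comm] by blast
  qed (rule *)
qed

text \<open>Coordinates exist only for a split norm, so \<open>\<phi>\<close> is constrained only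
  then; case \<open>rows\<close> provides the splitness it uses.\<close>

lemma commutative_classification:
  assumes \<phi>: "is_split N \<Longrightarrow> split_coordinates smul mul N \<phi>"
    and sub: "is_subalgebra smul mul A" and comm: "commutative_on mul A" and nz: "A \<noteq> {0}"
  shows "case_a smul A \<or> case_b smul e A \<or> case_c smul mul N \<phi> A \<or> case_d smul mul N \<phi> A \<or>
    (2::'f) = 0 \<and> (case_e smul mul N \<phi> A \<or> case_f smul mul N \<phi> A \<or> case_g smul mul e A)"
  using sub comm
proof (cases rule: commutative_cases)
  case (two_dim x)
  then show ?thesis
    using two_dim_cases nz subalgebraD(1)[OF sub] by blast
next
  case (rows \<phi>')
  have split: "is_split N"
    using rows(1) by (rule split_coordinates_is_split)
  note aut = split_coordinates_aut[OF \<phi>[OF split] rows(1)]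
  note dims = model_dims[OF rows(1)]
  show ?thesis
    using row_classification[OF rows(1) sub comm rows(2-5)]
    unfolding case_c_def case_d_def case_e_def case_f_def
    using split aut dims by blast
next
  case aniso
  then show ?thesis
    \<comment> \<open>If \<open>A\<close> lies in some span of \<open>e\<close> and
      \<open>x\<close>, the two-dimensional analysis applies; otherwise
      \<open>anisotropic_field\<close> does.\<close>
    using anisotropic_field(2)[OF sub comm] two_dim_cases nz subalgebraD(1)[OF sub] by blast
qed

section \<open>The small cases and the polynomial quotient\<close>

lemma commutative_case_ab:
  assumes "subspace A" "case_a smul A \<or> case_b smul e A"
  shows "commutative_on mul A"
proof -
  have *: "commutative_on mul (span {e, x})" for x
    by (auto simp: commutative_on_def in_span_2_iff alg_simps algebra_simps)
  show ?thesis
    using assms(2)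
  proof
    assume "case_a smul A"
    then obtain x where "A = span {x}"
      using dim_one_obtain assms(1) by (auto simp: case_a_def)
    then have "A \<subseteq> span {e, x}"
      by (simp add: span_mono)
    then show ?thesis
      using *[of x] by (auto simp: commutative_on_def)
  qed (use * in \<open>auto simp: case_b_def one_gen_span\<close>)
qed

text \<open>Evaluation at \<open>a\<close> of the remainder modulo the quadratic polynomial of
  \<open>a\<close>; dimension two makes it injective on remainders.\<close>

lemma one_gen_iso_poly_quotient:
  assumes dim: "dim (one_gen smul e a) = 2"
  shows "iso_poly_quotient smul mul e (one_gen smul e a) [:N a, - trace_form e N a, 1:]"
proof -
  define q where "q = [:N a, - trace_form e N a, 1:]"
  define val where "val p = coeff (p mod q) 0 \<cdot> e + coeff (p mod q) 1 \<cdot> a" for p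
  \<comment> \<open>The choice of a representative is harmless, since \<open>val\<close> depends
    only on the remainder modulo \<open>q\<close>.\<close>
  define \<psi> where "\<psi> C = val (SOME p. p \<in> C)" for C
  have q: "q \<noteq> 0" "degree q = 2" by (auto simp: q_def)
  have a: "a \<notin> span {e}"
  proof
    assume "a \<in> span {e}"
    then have "span {a, e} = span {e}"
      by (rule span_redundant)
    then have "dim (one_gen smul e a) = dim {e}"
      unfolding one_gen_span by (metis dim_span insert_commute)
    then show False using dim e_nonzero by (simp add: dim_one)
  qed
  have unique: "r = r' \<and> s = s'" if "r \<cdot> e + s \<cdot> a = r' \<cdot> e + s' \<cdot> a" for r s r' s'
  proof -
    have *: "(s - s') \<cdot> a = (r' - r) \<cdot> e"
      using that by (simp add: algebra_simps)
    have "s = s'"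
    proof (rule ccontr)
      assume "s \<noteq> s'"
      then have "a = (inverse (s - s') * (r' - r)) \<cdot> e"
        using * by (metis eq_iff_diff_eq_0 left_inverse scale_one scale_scale)
      then show False using a by (auto simp: span_singleton)
    qed
    then show ?thesis using * e_nonzero by simp
  qed
  have mod_q: "p mod q = [:coeff (p mod q) 0, coeff (p mod q) 1:]" for p
  proof (rule poly_eqI)
    fix n
    have "degree (p mod q) < 2"
      using degree_mod_less[of q p] q by auto
    then show "coeff (p mod q) n = coeff [:coeff (p mod q) 0, coeff (p mod q) 1:] n"
      by (cases n; cases "n - 1") (auto simp: coeff_pCons coeff_eq_0 split: nat.splits)
  qed
  have \<psi>: "\<psi> (poly_coset q p) = val p" for p
  proof -
    have "p \<in> poly_coset q p" by (simp add: poly_coset_def)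
    then have "(SOME r. r \<in> poly_coset q p) \<in> poly_coset q p" by (rule someI)
    then have "(SOME r. r \<in> poly_coset q p) mod q = p mod q"
      by (simp add: poly_coset_def mod_eq_dvd_iff)
    then show ?thesis by (simp add: \<psi>_def val_def)
  qed
  have val_less: "val p = coeff p 0 \<cdot> e + coeff p 1 \<cdot> a" if "degree p < 2" for p
    using that q by (simp add: val_def mod_poly_less)
  have val_mod: "val (p mod q) = val p" for p
    by (simp add: val_def)
  have inj: "inj_on \<psi> (range (poly_coset q))"
  proof (rule inj_onI, elim imageE)
    fix C C' p r assume *: "\<psi> C = \<psi> C'" "C = poly_coset q p" "C' = poly_coset q r"
    then have "val p = val r" by (simp add: \<psi>)
    then have "p mod q = r mod q"
      using unique mod_q by (metis val_def)
    then have "q dvd (t - p) \<longleftrightarrow> q dvd (t - r)" for t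
      by (simp flip: mod_eq_dvd_iff)
    then show "C = C'" by (simp add: * poly_coset_def)
  qed
  have surj: "\<psi> ` range (poly_coset q) = one_gen smul e a"
  proof -
    have "val [:r, s:] = r \<cdot> e + s \<cdot> a" for r s
      by (subst val_less) auto
    then have "r \<cdot> e + s \<cdot> a \<in> range val" for r s
      by (metis rangeI)
    moreover have "val p \<in> one_gen smul e a" for p
      by (auto simp: val_def one_gen_def)
    ultimately show ?thesis
      by (auto simp: image_image \<psi> one_gen_def)
  qed
  have val_mult: "val (p * r) = val p \<odot> val r" for p r
  proof -
    define b0 b1 c0 c1 where bc: "b0 = coeff (p mod q) 0" "b1 = coeff (p mod q) 1"
      "c0 = coeff (r mod q) 0" "c1 = coeff (r mod q) 1"
    have "(p * r) mod q = ((p mod q) * (r mod q)) mod q"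
      by (simp add: mod_mult_eq)
    also have "(p mod q) * (r mod q) = [:b0, b1:] * [:c0, c1:]"
      using mod_q by (metis bc)
    \<comment> \<open>One division step by \<open>q\<close> replaces the square of the variable by
      \<open>T a\<close> times the variable minus \<open>N a\<close>, exactly as
      \<open>square\<close> does for \<open>a\<close>.\<close>
    also have "\<dots> = [:b1 * c1:] * q + [:b0 * c0 - b1 * c1 * N a, b0 * c1 + b1 * c0 + b1 * c1 * T a:]"
      by (simp add: q_def trace_form_def algebra_simps)
    also have "\<dots> mod q = [:b0 * c0 - b1 * c1 * N a, b0 * c1 + b1 * c0 + b1 * c1 * T a:] mod q"
      by (rule mod_mult_self3)
    finally have "val (p * r) = val [:b0 * c0 - b1 * c1 * N a, b0 * c1 + b1 * c0 + b1 * c1 * T a:]"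
      by (simp only: val_def)
    also have "\<dots> = (b0 \<cdot> e + b1 \<cdot> a) \<odot> (c0 \<cdot> e + c1 \<cdot> a)"
      by (subst val_less) (auto simp: alg_simps square algebra_simps)
    finally show ?thesis by (simp add: val_def bc)
  qed
  have "val 1 = e" by (subst val_less) auto
  moreover have "val (p + r) = val p + val r" for p r
    by (simp add: val_def poly_mod_add_left algebra_simps)
  moreover have "val (smult c p) = c \<cdot> val p" for c p
    by (simp add: val_def mod_smult_left algebra_simps)
  ultimately show ?thesis
    unfolding iso_poly_quotient_def q_def[symmetric]
    using inj surj by (intro exI[of _ \<psi>]) (simp add: bij_betw_def \<psi> val_mult)
qed

end

section \<open>Commutativity of the models, and the theorem\<close>

lemma commutative_models:
  "commutative_on std_mult (model_null :: ('f::field mat2 \<times> 'f mat2) set)"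
  "commutative_on std_mult (model_unital_null :: ('f mat2 \<times> 'f mat2) set)"
  by (auto simp: commutative_on_def model_null_def model_unital_null_def mat22_special algebra_simps)

text \<open>In characteristic two a matrix of trace zero equals its adjugate, which makes it commute
  with the first rows.\<close>

lemma commutative_models_char_2:
  assumes "(2::'f::field) = 0"
  shows "commutative_on std_mult (model_heisenberg :: ('f mat2 \<times> 'f mat2) set)"
    and "polar std_norm (b, 0) (mat 1 :: 'f mat2, 0) = 0 \<Longrightarrow> commutative_on std_mult (model_B b)"
proof -
  have neg: "- x = x" for x :: 'f
    using assms by (metis add.inverse_unique mult_2 mult_zero_left)
  show "commutative_on std_mult (model_heisenberg :: ('f mat2 \<times> 'f mat2) set)"
    by (auto simp: commutative_on_def model_heisenberg_def mat22_special neg)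
  obtain p q r s where b: "b = mat22 p q r s" by (rule mat22_cases)
  show "commutative_on std_mult (model_B b)" if "polar std_norm (b, 0) (mat 1, 0) = 0"
  proof -
    have "p + s = 0"
      using that by (simp add: b mat22_special polar_std_norm)
    then have "s = p" using neg[of p] by (simp add: add_eq_0_iff)
    then show ?thesis
      by (auto simp: commutative_on_def model_B_def mat22_special b neg algebra_simps)
  qed
qed

lemma CHAR_eq_2_iff: "CHAR('f::field) = 2 \<longleftrightarrow> (2::'f) = 0"
proof -
  have "(2::'f) = 0 \<longleftrightarrow> CHAR('f) dvd 2"
    using of_nat_eq_0_iff_char_dvd[where 'a = 'f, of 2] by simp
  moreover have "CHAR('f) \<noteq> 1"
    using of_nat_CHAR[where 'a = 'f] by auto
  ultimately show ?thesis
    by (metis dvd_refl prime_nat_iff two_is_prime_nat)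
qed

text \<open>The subalgebra \<open>{0}\<close> is commutative but has dimension zero, hence its
  exclusion from the completeness claims. Quantifying over \<open>\<phi>\<close> makes the result
  independent of the identification with the matrix model.\<close>

theorem mainTheorem5:
  fixes smul :: "'f::field \<Rightarrow> 'a::ab_group_add \<Rightarrow> 'a"
    and mul :: "'a \<Rightarrow> 'a \<Rightarrow> 'a" and e :: 'a and N :: "'a \<Rightarrow> 'f"
  assumes "octonion_algebra smul mul e N"
  shows "(is_split N \<longrightarrow> (\<exists>\<phi>. split_coordinates smul mul N \<phi>)) \<and>
    (\<forall>\<phi> A. (is_split N \<longrightarrow> split_coordinates smul mul N \<phi>) \<longrightarrow> is_subalgebra smul mul A \<longrightarrow>
      (case_a smul A \<or> case_b smul e A \<or> case_c smul mul N \<phi> A \<or> case_d smul mul N \<phi> A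
        \<longrightarrow> commutative_on mul A) \<and>
      (\<forall>a. vector_space.dim smul A = 2 \<and> A = one_gen smul e a \<longrightarrow>
        iso_poly_quotient smul mul e A [:N a, - trace_form e N a, 1:]) \<and>
      (CHAR('f) \<noteq> 2 \<and> A \<noteq> {0} \<and> commutative_on mul A \<longrightarrow>
        case_a smul A \<or> case_b smul e A \<or> case_c smul mul N \<phi> A \<or> case_d smul mul N \<phi> A) \<and>
      (CHAR('f) = 2 \<and>
        (case_e smul mul N \<phi> A \<or> case_f smul mul N \<phi> A \<or> case_g smul mul e A)
        \<longrightarrow> commutative_on mul A) \<and>
      (CHAR('f) = 2 \<and> A \<noteq> {0} \<and> commutative_on mul A \<longrightarrow>
        case_a smul A \<or> case_b smul e A \<or> case_c smul mul N \<phi> A \<or> case_d smul mul N \<phi> A \<or>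
        case_e smul mul N \<phi> A \<or> case_f smul mul N \<phi> A \<or> case_g smul mul e A) \<and>
      (commutative_on mul A \<longrightarrow> associative_on mul A))"
proof -
  interpret octonion_algebra smul mul e N by (rule assms)
  show ?thesis
  proof (intro conjI allI impI)
    show "\<exists>\<phi>. split_coordinates smul mul N \<phi>" if "is_split N"
      using that by (rule split_coordinates_exist)
  next
    fix \<phi> A
    assume \<phi>: "is_split N \<longrightarrow> split_coordinates smul mul N \<phi>" and sub: "is_subalgebra smul mul A"
    note orbit = commutative_orbit[OF \<phi>[rule_format]]
    note cl = commutative_classification[OF \<phi>[rule_format] sub]
    show "commutative_on mul A"
      if "case_a smul A \<or> case_b smul e A \<or> case_c smul mul N \<phi> A \<or> case_d smul mul N \<phi> A"
      using that commutative_case_ab[OF subalgebraD(1)[OF sub]] orbit[OF _ commutative_models(1)]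
        orbit[OF _ commutative_models(2)]
      unfolding case_c_def case_d_def by blast
    show "iso_poly_quotient smul mul e A [:N a, - trace_form e N a, 1:]"
      if "dim A = 2 \<and> A = one_gen smul e a" for a
      using that one_gen_iso_poly_quotient by blast
    show "case_a smul A \<or> case_b smul e A \<or> case_c smul mul N \<phi> A \<or> case_d smul mul N \<phi> A"
      if "CHAR('f) \<noteq> 2 \<and> A \<noteq> {0} \<and> commutative_on mul A"
      using that cl by (auto simp: CHAR_eq_2_iff)
    show "commutative_on mul A"
      if "CHAR('f) = 2 \<and> (case_e smul mul N \<phi> A \<or> case_f smul mul N \<phi> A \<or> case_g smul mul e A)"
    proof -
      have two: "(2::'f) = 0" using that by (simp add: CHAR_eq_2_iff)
      show ?thesis
        using that orbit[OF _ commutative_models_char_2(1)[OF two]]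
          orbit[OF _ commutative_models_char_2(2)[OF two]]
        unfolding case_e_def case_f_def case_g_def field_extension_in_def by blast
    qed
    show "case_a smul A \<or> case_b smul e A \<or> case_c smul mul N \<phi> A \<or> case_d smul mul N \<phi> A \<or>
        case_e smul mul N \<phi> A \<or> case_f smul mul N \<phi> A \<or> case_g smul mul e A"
      if "CHAR('f) = 2 \<and> A \<noteq> {0} \<and> commutative_on mul A"
      using that cl by blast
    show "associative_on mul A" if "commutative_on mul A"
      using sub that by (rule commutative_imp_associative)
  qed
qed

end
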